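(* Let $B$ be a Boolean $\sigma$-algebra and $\mathcal{A}$ a $\sigma C^*$-algebra. For every $\mathcal{A}$-valued POVM $\mu\colon B\to\mathcal{A}$ there is a unique $\sigma$-normal completely positive unital map $\phi\colon C(\mathrm{Stone}(B))\to\mathcal{A}$ with $\phi(\chi_p)=\mu(p)$ for all $p\in B$, where $\chi_p$ is the indicator function of the clopen set in $\mathrm{Stone}(B)$ corresponding to $p$. Moreover, $\phi$ is unique even among all positive maps with this property. Thus POVMs $B\to\mathcal{A}$ correspond bijectively to $\sigma$-normal cpu maps $C(\mathrm{Stone}(B))\to\mathcal{A}$.
   Context: All $C^*$-algebras are unital. A $\sigma C^*$-algebra is a $C^*$-algebra in which every norm-bounded increasing sequence of self-adjoint elements has a supremum in the self-adjoint poset. A positive unital map is $\sigma$-normal if it preserves suprema of bounded increasing self-adjoint sequences whenever these exist in the domain. A Boolean $\sigma$-algebra is a Boolean algebra with all countable suprema and infima; $\mathrm{Stone}(B)$ is its Stone space, and $C(\mathrm{Stone}(B))$ is a commutative $\sigma C^*$-algebra (the paper denotes an isomorphic algebra $\mathscr{L}^\infty_{\mathrm{abs}}(B)$). An $\mathcal{A}$-valued POVM on $B$ is a map $\mu\colon B\to\mathcal{A}$ with $\mu(p)\ge0$ for all $p$, $\mu(\top)=1$, and $\mu(\sup_n p_n)=\sum_n\mu(p_n)$ (the infinite sum, i.e. supremum of finite partial sums, existing and being equal) for every sequence of pairwise disjoint elements $p_n$ (i.e. $p_n\wedge p_m=\bot$ for $n\neq m$). *)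

theory Defs
  imports "HOL-Analysis.Analysis"
begin

class cstar_algebra = real_normed_algebra_1 + banach +
  fixes scaleC :: "complex \<Rightarrow> 'a \<Rightarrow> 'a"
    and adj :: "'a \<Rightarrow> 'a"
  assumes scaleC_add_right: "scaleC c (x + y) = scaleC c x + scaleC c y"
    and scaleC_add_left: "scaleC (c + d) x = scaleC c x + scaleC d x"
    and scaleC_scaleC: "scaleC c (scaleC d x) = scaleC (c * d) x"
    and scaleC_one: "scaleC 1 x = x"
    and scaleC_of_real: "scaleC (complex_of_real r) x = scaleR r x"
    and norm_scaleC: "norm (scaleC c x) = cmod c * norm x"
    and scaleC_mult_left: "scaleC c x * y = scaleC c (x * y)"
    and scaleC_mult_right: "x * scaleC c y = scaleC c (x * y)"
    and adj_adj: "adj (adj x) = x"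
    and adj_add: "adj (x + y) = adj x + adj y"
    and adj_scaleC: "adj (scaleC c x) = scaleC (cnj c) (adj x)"
    and adj_mult: "adj (x * y) = adj y * adj x"
    and cstar_identity: "norm (adj x * x) = norm x * norm x"

definition A_sa :: "'a::cstar_algebra \<Rightarrow> bool" where
  "A_sa x \<longleftrightarrow> adj x = x"

definition A_pos :: "'a::cstar_algebra \<Rightarrow> bool" where
  "A_pos x \<longleftrightarrow> (\<exists>y. x = adj y * y)"

definition A_le :: "'a::cstar_algebra \<Rightarrow> 'a \<Rightarrow> bool" where
  "A_le x y \<longleftrightarrow> A_pos (y - x)"

definition A_is_sup :: "(nat \<Rightarrow> 'a::cstar_algebra) \<Rightarrow> 'a \<Rightarrow> bool" where
  "A_is_sup s x \<longleftrightarrow> A_sa x \<and> (\<forall>n. A_le (s n) x) \<and>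
     (\<forall>y. A_sa y \<and> (\<forall>n. A_le (s n) y) \<longrightarrow> A_le x y)"

definition sigma_cstar :: "'a::cstar_algebra itself \<Rightarrow> bool" where
  "sigma_cstar _ \<longleftrightarrow> (\<forall>s::nat \<Rightarrow> 'a.
     (\<forall>n. A_sa (s n)) \<and> (\<exists>M. \<forall>n. norm (s n) \<le> M) \<and> (\<forall>n. A_le (s n) (s (Suc n)))
     \<longrightarrow> (\<exists>x. A_is_sup s x))"

definition B_is_lub :: "'b::boolean_algebra \<Rightarrow> 'b set \<Rightarrow> bool" where
  "B_is_lub s P \<longleftrightarrow> (\<forall>p\<in>P. p \<le> s) \<and> (\<forall>t. (\<forall>p\<in>P. p \<le> t) \<longrightarrow> s \<le> t)"

definition B_is_glb :: "'b::boolean_algebra \<Rightarrow> 'b set \<Rightarrow> bool" where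
  "B_is_glb s P \<longleftrightarrow> (\<forall>p\<in>P. s \<le> p) \<and> (\<forall>t. (\<forall>p\<in>P. t \<le> p) \<longrightarrow> t \<le> s)"

definition bool_sigma :: "'b::boolean_algebra itself \<Rightarrow> bool" where
  "bool_sigma _ \<longleftrightarrow> (\<forall>P::'b set. countable P \<longrightarrow> (\<exists>s. B_is_lub s P) \<and> (\<exists>s. B_is_glb s P))"

definition povm :: "('b::boolean_algebra \<Rightarrow> 'a::cstar_algebra) \<Rightarrow> bool" where
  "povm \<mu> \<longleftrightarrow> (\<forall>p. A_pos (\<mu> p)) \<and> \<mu> top = 1 \<and>
     (\<forall>(q::nat \<Rightarrow> 'b) s. (\<forall>n m. n \<noteq> m \<longrightarrow> inf (q n) (q m) = bot) \<and> B_is_lub s (range q)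
        \<longrightarrow> A_is_sup (\<lambda>n. \<Sum>k<n. \<mu> (q k)) (\<mu> s))"

definition ultrafilter_B :: "'b::boolean_algebra set \<Rightarrow> bool" where
  "ultrafilter_B U \<longleftrightarrow> bot \<notin> U \<and> top \<in> U \<and>
     (\<forall>p q. p \<in> U \<and> p \<le> q \<longrightarrow> q \<in> U) \<and>
     (\<forall>p q. p \<in> U \<and> q \<in> U \<longrightarrow> inf p q \<in> U) \<and>
     (\<forall>p. p \<in> U \<or> - p \<in> U)"

definition stone :: "'b::boolean_algebra set set" where
  "stone = {U. ultrafilter_B U}"

definition stone_clopen :: "'b::boolean_algebra \<Rightarrow> 'b set set" where
  "stone_clopen p = {U \<in> stone. p \<in> U}"

definition stone_top :: "'b::boolean_algebra set topology" where
  "stone_top = topology_generated_by (range stone_clopen)"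

text \<open>C(Stone(B)): continuous complex functions on the Stone space, represented
extensionally (value 0 outside the Stone space); all operations pointwise.\<close>
definition CS :: "('b::boolean_algebra set \<Rightarrow> complex) set" where
  "CS = {f. continuous_map stone_top euclidean f \<and> (\<forall>U. U \<notin> stone \<longrightarrow> f U = 0)}"

definition chi :: "'b::boolean_algebra \<Rightarrow> 'b set \<Rightarrow> complex" where
  "chi p = (\<lambda>U. if U \<in> stone_clopen p then 1 else 0)"

definition C_sa :: "('b::boolean_algebra set \<Rightarrow> complex) \<Rightarrow> bool" where
  "C_sa f \<longleftrightarrow> (\<forall>U. Im (f U) = 0)"

definition C_le :: "('b::boolean_algebra set \<Rightarrow> complex) \<Rightarrow> ('b set \<Rightarrow> complex) \<Rightarrow> bool" where
  "C_le f g \<longleftrightarrow> (\<forall>U\<in>stone. Re (f U) \<le> Re (g U))"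

definition C_is_sup :: "(nat \<Rightarrow> 'b::boolean_algebra set \<Rightarrow> complex) \<Rightarrow> ('b set \<Rightarrow> complex) \<Rightarrow> bool" where
  "C_is_sup s f \<longleftrightarrow> f \<in> CS \<and> C_sa f \<and> (\<forall>n. C_le (s n) f) \<and>
     (\<forall>g\<in>CS. C_sa g \<and> (\<forall>n. C_le (s n) g) \<longrightarrow> C_le f g)"

definition C_linear :: "(('b::boolean_algebra set \<Rightarrow> complex) \<Rightarrow> 'a::cstar_algebra) \<Rightarrow> bool" where
  "C_linear \<phi> \<longleftrightarrow> (\<forall>f\<in>CS. \<forall>g\<in>CS. \<phi> (\<lambda>U. f U + g U) = \<phi> f + \<phi> g) \<and>
     (\<forall>f\<in>CS. \<forall>c. \<phi> (\<lambda>U. c * f U) = scaleC c (\<phi> f))"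

definition C_unital :: "(('b::boolean_algebra set \<Rightarrow> complex) \<Rightarrow> 'a::cstar_algebra) \<Rightarrow> bool" where
  "C_unital \<phi> \<longleftrightarrow> \<phi> (chi top) = 1"

definition C_positive :: "(('b::boolean_algebra set \<Rightarrow> complex) \<Rightarrow> 'a::cstar_algebra) \<Rightarrow> bool" where
  "C_positive \<phi> \<longleftrightarrow> (\<forall>f\<in>CS. (\<forall>U\<in>stone. Im (f U) = 0 \<and> Re (f U) \<ge> 0) \<longrightarrow> A_pos (\<phi> f))"

text \<open>Completely positive: for every n, the amplification to n\<times>n matrices maps positive
matrices (those of the form G* G in M_n(C(Stone B))) to positive matrices (those of the
form Y* Y in M_n(A)). Matrices are functions nat \<Rightarrow> nat \<Rightarrow> _ on indices < n.\<close>
definition C_completely_positive :: "(('b::boolean_algebra set \<Rightarrow> complex) \<Rightarrow> 'a::cstar_algebra) \<Rightarrow> bool" where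
  "C_completely_positive \<phi> \<longleftrightarrow> (\<forall>(n::nat) (G::nat \<Rightarrow> nat \<Rightarrow> 'b set \<Rightarrow> complex).
     (\<forall>i<n. \<forall>j<n. G i j \<in> CS) \<longrightarrow>
     (\<exists>Y::nat \<Rightarrow> nat \<Rightarrow> 'a. \<forall>i<n. \<forall>j<n.
        \<phi> (\<lambda>U. \<Sum>k<n. cnj (G k i U) * G k j U) = (\<Sum>k<n. adj (Y k i) * Y k j)))"

definition C_sigma_normal :: "(('b::boolean_algebra set \<Rightarrow> complex) \<Rightarrow> 'a::cstar_algebra) \<Rightarrow> bool" where
  "C_sigma_normal \<phi> \<longleftrightarrow> (\<forall>s f. (\<forall>n. s n \<in> CS \<and> C_sa (s n)) \<and>
       (\<exists>M. \<forall>n. \<forall>U. cmod (s n U) \<le> M) \<and> (\<forall>n. C_le (s n) (s (Suc n))) \<and> C_is_sup s f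
     \<longrightarrow> A_is_sup (\<lambda>n. \<phi> (s n)) (\<phi> f))"

end

theory Submission
  imports Defs
begin

text \<open>
  The map \<open>\<phi>\<close> is the integral against \<open>\<mu>\<close>: by compactness of the Stone space every continuous
  function is nearly constant on the pieces of some finite clopen partition, and the Riemann sums
  \<open>\<Sum> f(U\<^sub>p) \<mu>(p)\<close> converge in norm because an operator convex combination of small scalars is small.
  A positive linear map with the prescribed values on indicators is squeezed between Riemann sums,
  which gives uniqueness. For complete positivity, \<open>\<phi>(G\<^sup>* G)\<close> has a positive quadratic form over
  the Hilbert module \<open>A\<^sup>n\<close>, and a hermitian matrix with positive form has a square root, obtained as
  a limit of the iteration \<open>P \<mapsto> (Z + P\<^sup>2) / 2\<close>. The same iteration yields square roots in \<open>A\<close>, and from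
  them the order theory of \<open>A\<close>, including Kaplansky's theorem that \<open>y\<^sup>* y\<close> is the square of a
  self-adjoint element. For \<open>\<sigma>\<close>-normality, if \<open>s\<^sub>n\<close> increases to \<open>f\<close>, then \<open>f - s\<^sub>n\<close> is at most \<open>2e\<close>
  off a decreasing sequence of clopen sets whose infimum is \<open>bot\<close>, and countable additivity applies.
\<close>

section \<open>Adjoints and self-adjoint elements\<close>

text \<open>From the form \<open>x = adj y * y\<close> of \<open>A_pos\<close> it is not even
  evident that sums of positive elements are positive. The handle is the norm test
  \<open>norm (of_real c - x) \<le> c\<close>, which adds up by the triangle inequality and survives
  limits; square roots translate between it and squares of self-adjoint elements, so no spectral
  theory has to be set up. Roots that commute with whatever commutes with the radicand take the
  place of the functional calculus. Matrices over \<open>A\<close> are bare functions without a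
  norm, so there the root iteration is controlled by an inequality between \<open>A\<close>-valued
  forms. In sigma-normality the obstacle is that the order supremum \<open>f\<close> of the
  \<open>s n\<close> need not be their pointwise supremum. What saves the argument is that the
  points where every \<open>s n\<close> stays at least \<open>e\<close> below \<open>f\<close>
  contain no nonempty clopen set: lowering \<open>f\<close> by \<open>e\<close> on such a set would
  leave a smaller continuous upper bound.\<close>

lemma adj_zero [simp]: "adj (0::'a::cstar_algebra) = 0"
  using adj_add[of "0::'a" 0] by simp

lemma adj_minus: "adj (- x) = - adj (x::'a::cstar_algebra)"
  using adj_add[of x "- x"] by (simp add: add_eq_0_iff)

lemma adj_diff: "adj (x - y) = adj x - adj (y::'a::cstar_algebra)"
  using adj_add[of x "- y"] by (simp add: adj_minus)

lemma adj_one [simp]: "adj (1::'a::cstar_algebra) = 1"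
proof -
  have "adj (adj (1::'a) * 1) = adj 1 * adj (adj 1)" by (rule adj_mult)
  then show ?thesis by (metis adj_adj mult_1_right)
qed

lemma adj_scaleR: "adj (r *\<^sub>R x) = r *\<^sub>R adj (x::'a::cstar_algebra)"
  by (metis adj_scaleC complex_cnj_complex_of_real scaleC_of_real)

lemma adj_of_real [simp]: "adj (of_real r :: 'a::cstar_algebra) = of_real r"
  by (simp add: of_real_def adj_scaleR)

lemma adj_sum: "adj (sum f A) = (\<Sum>i\<in>A. adj (f i :: 'a::cstar_algebra))"
  by (induction A rule: infinite_finite_induct) (simp_all add: adj_add)

text \<open>No axiom makes the involution isometric; cancelling \<open>norm y\<close> in the
  C*-identity gives one inequality, and the other is the same one at \<open>adj x\<close>.\<close>

lemma norm_adj: "norm (adj x) = norm (x::'a::cstar_algebra)"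
proof -
  have le: "norm y \<le> norm (adj y)" for y :: 'a
  proof (cases "y = 0")
    case False
    have "norm y * norm y \<le> norm (adj y) * norm y"
      by (metis cstar_identity norm_mult_ineq)
    then show ?thesis using False by simp
  qed simp
  show ?thesis using le[of x] le[of "adj x"] by (simp add: adj_adj)
qed

lemma bounded_linear_adj: "bounded_linear (adj :: 'a::cstar_algebra \<Rightarrow> 'a)"
  by (rule bounded_linear_intro[where K=1]) (simp_all add: adj_add adj_scaleR norm_adj)

lemmas tendsto_adj [tendsto_intros] = bounded_linear.tendsto[OF bounded_linear_adj]

lemma bounded_linear_scaleC: "bounded_linear (scaleC c :: 'a::cstar_algebra \<Rightarrow> 'a)"
proof (rule bounded_linear_intro[where K="cmod c"])
  show "scaleC c (r *\<^sub>R x) = r *\<^sub>R scaleC c x" for r and x :: 'a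
    by (metis scaleC_of_real scaleC_scaleC mult.commute)
qed (simp_all add: scaleC_add_right norm_scaleC mult.commute)

lemma scaleC_zero_right [simp]: "scaleC c (0::'a::cstar_algebra) = 0"
  by (rule linear_simps(3)[OF bounded_linear_scaleC])

lemma scaleC_diff_right: "scaleC c (x - y) = scaleC c x - scaleC c (y::'a::cstar_algebra)"
  by (rule linear_simps(2)[OF bounded_linear_scaleC])

lemma scaleC_zero_left [simp]: "scaleC 0 x = (0::'a::cstar_algebra)"
  using scaleC_add_left[of 0 0 x] by simp

lemma scaleC_minus_left: "scaleC (- c) x = - scaleC c (x::'a::cstar_algebra)"
  using scaleC_add_left[of c "- c" x] by (simp add: add_eq_0_iff)

lemma scaleC_diff_left: "scaleC (c - d) x = scaleC c x - scaleC d (x::'a::cstar_algebra)"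
  using scaleC_add_left[of c "- d" x] by (simp add: scaleC_minus_left)

lemma scaleC_sum_right: "scaleC c (sum f A) = (\<Sum>i\<in>A. scaleC c (f i :: 'a::cstar_algebra))"
  by (induction A rule: infinite_finite_induct) (simp_all add: scaleC_add_right)

lemma scaleC_sum_left: "scaleC (sum f A) x = (\<Sum>i\<in>A. scaleC (f i) (x :: 'a::cstar_algebra))"
  by (induction A rule: infinite_finite_induct) (simp_all add: scaleC_add_left)

lemma adj_mult_self_eq_0: "adj x * x = 0 \<longleftrightarrow> (x::'a::cstar_algebra) = 0"
  using cstar_identity[of x] by auto

lemma A_sa_simps:
  "A_sa (0::'a::cstar_algebra)" "A_sa (1::'a)" "A_sa (of_real r :: 'a)"
  "A_sa x \<Longrightarrow> A_sa y \<Longrightarrow> A_sa (x + y)"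
  "A_sa x \<Longrightarrow> A_sa y \<Longrightarrow> A_sa (x - y)"
  "A_sa x \<Longrightarrow> A_sa (- x)"
  "A_sa x \<Longrightarrow> A_sa (r *\<^sub>R x)"
  "A_sa x \<Longrightarrow> A_sa (x * x)"
  "A_sa (adj z * z)"
  for x y z :: "'a::cstar_algebra"
  by (simp_all add: A_sa_def adj_add adj_diff adj_minus adj_scaleR adj_mult adj_adj)

lemma A_sa_limit:
  fixes x :: "nat \<Rightarrow> 'a::cstar_algebra"
  assumes "x \<longlonglongrightarrow> l" "\<And>n. A_sa (x n)"
  shows "A_sa l"
  using LIMSEQ_unique[OF tendsto_adj[OF assms(1)]] assms by (simp add: A_sa_def)

lemma norm_mult_self: "A_sa x \<Longrightarrow> norm (x * x) = norm x * norm (x::'a::cstar_algebra)"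
  using cstar_identity[of x] by (simp add: A_sa_def)

section \<open>Square roots\<close>

text \<open>The scalar iteration for \<open>1 - sqrt (1 - z)\<close> at \<open>z = 1\<close>, which majorises the iteration
  at every \<open>z\<close> with \<open>norm z \<le> 1\<close>.\<close>

primrec sqrt_maj :: "nat \<Rightarrow> real" where
  "sqrt_maj 0 = 1/2"
| "sqrt_maj (Suc n) = (1 + sqrt_maj n * sqrt_maj n) / 2"

lemma sqrt_maj_bounds: "0 < sqrt_maj n" "sqrt_maj n < 1"
proof -
  have "0 < sqrt_maj n \<and> sqrt_maj n < 1"
  proof (induction n)
    case (Suc n)
    then have "sqrt_maj n * sqrt_maj n < 1 * 1" by (intro mult_strict_mono) auto
    with Suc show ?case by (simp add: add_pos_pos)
  qed simp
  then show "0 < sqrt_maj n" "sqrt_maj n < 1" by auto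
qed

lemma sqrt_maj_less: "sqrt_maj n < sqrt_maj (Suc n)"
proof -
  \<comment> \<open>Half of this square is exactly the increment
    \<open>sqrt_maj (Suc n) - sqrt_maj n\<close>.\<close>
  have "0 < (1 - sqrt_maj n) * (1 - sqrt_maj n)" using sqrt_maj_bounds[of n] by simp
  then show ?thesis by (simp add: algebra_simps)
qed

text \<open>The increments of the bounded increasing \<open>sqrt_maj\<close> telescope to a
  convergent series, which dominates that of \<open>X\<close>. Serves both elements of
  \<open>A\<close> and entries of matrices.\<close>

lemma convergent_if_increments_le_sqrt_maj:
  fixes X :: "nat \<Rightarrow> 'a::banach"
  assumes "\<And>n. norm (X (Suc n) - X n) \<le> sqrt_maj (Suc n) - sqrt_maj n"
  shows "convergent X"
proof -
  have "convergent sqrt_maj"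
  proof (rule Bseq_mono_convergent)
    show "Bseq sqrt_maj"
      using sqrt_maj_bounds by (intro BseqI'[of _ 1]) (simp add: less_imp_le)
    show "\<forall>m. \<forall>n\<ge>m. sqrt_maj m \<le> sqrt_maj n"
      using lift_Suc_mono_le[of sqrt_maj] sqrt_maj_less less_imp_le by metis
  qed
  then obtain l where "sqrt_maj \<longlonglongrightarrow> l" by (auto simp: convergent_def)
  then have "summable (\<lambda>n. sqrt_maj (Suc n) - sqrt_maj n)"
    by (rule telescope_summable)
  then have "summable (\<lambda>n. X (Suc n) - X n)"
    by (rule summable_comparison_test'[where N=0]) (use assms in auto)
  then have "convergent (\<lambda>n. (\<Sum>k<n. X (Suc k) - X k) + X 0)"
    using summable_LIMSEQ by (intro convergent_add) (auto simp: convergent_def)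
  then show ?thesis by (simp add: sum_lessThan_telescope)
qed

text \<open>The equation \<open>(1 - p)^2 = 1 - z\<close> reads \<open>p = (z + p^2) / 2\<close> as
  a fixed-point problem; the start \<open>z / 2\<close> is one step from \<open>0\<close>.\<close>

primrec sqrt_iter :: "'a::real_normed_algebra_1 \<Rightarrow> nat \<Rightarrow> 'a" where
  "sqrt_iter z 0 = (1/2) *\<^sub>R z"
| "sqrt_iter z (Suc n) = (1/2) *\<^sub>R (z + sqrt_iter z n * sqrt_iter z n)"

lemma norm_sqrt_iter:
  assumes "norm z \<le> 1"
  shows "norm (sqrt_iter z n) \<le> sqrt_maj n"
proof (induction n)
  case (Suc n)
  have "norm (z + sqrt_iter z n * sqrt_iter z n) \<le> 1 + sqrt_maj n * sqrt_maj n"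
    by (intro norm_triangle_le add_mono assms norm_mult_ineq[THEN order_trans] mult_mono Suc)
      (use Suc norm_ge_zero order_trans in blast)+
  then show ?case by simp
qed (use assms in simp)

lemma norm_sqrt_iter_diff:
  assumes "norm z \<le> 1"
  shows "norm (sqrt_iter z (Suc n) - sqrt_iter z n) \<le> sqrt_maj (Suc n) - sqrt_maj n"
proof (induction n)
  case 0
  have "norm (z * z) \<le> 1 * 1"
    by (intro norm_mult_ineq[THEN order_trans] mult_mono assms) auto
  \<comment> \<open>The constant is \<open>sqrt_maj 1 - sqrt_maj 0 = 5/8 - 1/2\<close>.\<close>
  moreover have "sqrt_iter z (Suc 0) - sqrt_iter z 0 = (1/8) *\<^sub>R (z * z)"
    by (simp add: algebra_simps)
  ultimately show ?case by simp
next
  case (Suc n)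
  let ?p = "sqrt_iter z (Suc n)" and ?q = "sqrt_iter z n"
  let ?r = "sqrt_maj (Suc n)" and ?s = "sqrt_maj n"
  have pos: "0 \<le> ?r" "0 \<le> ?s" "0 \<le> ?r - ?s"
    using sqrt_maj_bounds sqrt_maj_less[of n] less_imp_le
    by (simp_all only: diff_ge_0_iff_ge less_imp_le)
  \<comment> \<open>A difference of squares factors as \<open>p (p - q) + (p - q) q\<close> without
    commutativity.\<close>
  have "sqrt_iter z (Suc (Suc n)) - ?p = (1/2) *\<^sub>R (?p * (?p - ?q) + (?p - ?q) * ?q)"
    by (simp add: algebra_simps)
  moreover have "norm (?p * (?p - ?q) + (?p - ?q) * ?q) \<le> ?r * (?r - ?s) + (?r - ?s) * ?s"
    by (intro norm_triangle_le add_mono norm_mult_ineq[THEN order_trans] mult_mono Suc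
        norm_sqrt_iter assms norm_ge_zero pos)
  ultimately have "norm (sqrt_iter z (Suc (Suc n)) - ?p) \<le> (?r * (?r - ?s) + (?r - ?s) * ?s) / 2"
    by simp
  also have "\<dots> = sqrt_maj (Suc (Suc n)) - ?r" by (simp add: field_simps)
  finally show ?case .
qed

lemma A_sa_sqrt_iter: "A_sa z \<Longrightarrow> A_sa (sqrt_iter z n)"
  by (induction n) (simp_all add: A_sa_simps)

lemma sqrt_iter_commute: "x * z = z * x \<Longrightarrow> x * sqrt_iter z n = sqrt_iter z n * x"
proof (induction n)
  case (Suc n)
  have "x * (sqrt_iter z n * sqrt_iter z n) = sqrt_iter z n * sqrt_iter z n * x"
    by (metis Suc mult.assoc)
  then show ?case using Suc.prems by (simp add: algebra_simps)
qed simp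

text \<open>The root is \<open>1 - p\<close> for the limit \<open>p\<close> of the iteration. Of the
  extra conclusions, \<open>norm (1 - s) \<le> 1\<close> lets the root pass the norm test itself,
  and the commutation clause makes roots of commuting elements commute.\<close>

lemma sqrt_one_minus_exists:
  fixes z :: "'a::cstar_algebra"
  assumes "A_sa z" "norm z \<le> 1"
  obtains s where "A_sa s" "s * s = 1 - z" "norm (1 - s) \<le> 1" "\<And>x. x * z = z * x \<Longrightarrow> x * s = s * x"
proof -
  obtain p where p: "sqrt_iter z \<longlonglongrightarrow> p"
    using convergent_if_increments_le_sqrt_maj[of "sqrt_iter z"] norm_sqrt_iter_diff[OF assms(2)]
    by (auto simp: convergent_def)
  have "(\<lambda>n. sqrt_iter z (Suc n)) \<longlonglongrightarrow> (1/2) *\<^sub>R (z + p * p)"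
    unfolding sqrt_iter.simps by (intro tendsto_intros p)
  with LIMSEQ_Suc[OF p] have "p = (1/2) *\<^sub>R (z + p * p)" by (rule LIMSEQ_unique)
  then have "2 *\<^sub>R p = 2 *\<^sub>R ((1/2) *\<^sub>R (z + p * p))" by (rule arg_cong)
  then have e: "p + p = z + p * p" by (simp add: scaleR_2)
  show thesis
  proof
    show "A_sa (1 - p)"
      using A_sa_limit[OF p] A_sa_sqrt_iter[OF assms(1)] by (simp add: A_sa_simps)
    have "(1 - p) * (1 - p) = 1 - (p + p) + p * p" by (simp add: algebra_simps)
    then show "(1 - p) * (1 - p) = 1 - z" using e by simp
    have "norm p \<le> 1"
      using norm_sqrt_iter[OF assms(2)] sqrt_maj_bounds(2) less_imp_le order_trans
      by (intro LIMSEQ_le_const2[OF tendsto_norm[OF p]]) blast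
    then show "norm (1 - (1 - p)) \<le> 1" by simp
    fix x assume "x * z = z * x"
    then have "(\<lambda>n. x * sqrt_iter z n) = (\<lambda>n. sqrt_iter z n * x)"
      by (simp add: sqrt_iter_commute)
    moreover have "(\<lambda>n. x * sqrt_iter z n) \<longlonglongrightarrow> x * p" "(\<lambda>n. sqrt_iter z n * x) \<longlonglongrightarrow> p * x"
      by (intro tendsto_intros p)+
    ultimately have "x * p = p * x" using LIMSEQ_unique by metis
    then show "x * (1 - p) = (1 - p) * x" by (simp add: algebra_simps)
  qed
qed

section \<open>Positive elements\<close>

text \<open>Provisional notion of positivity, on which the order theory is built before
  \<open>adj y * y\<close> is known to qualify; \<open>A_pos_iff_sa_square\<close> identifies the
  two.\<close>

definition sa_square :: "'a::cstar_algebra \<Rightarrow> bool" where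
  "sa_square x \<longleftrightarrow> (\<exists>s. A_sa s \<and> x = s * s)"

text \<open>The norm test says precisely that \<open>z = 1 - x / c\<close> has norm at most
  \<open>1\<close>, so the root of \<open>1 - z\<close> can be rescaled by
  \<open>sqrt c\<close>.\<close>

lemma sqrt_exists_if_norm_le:
  fixes x :: "'a::cstar_algebra"
  assumes "A_sa x" "norm (of_real c - x) \<le> c"
  obtains s where "A_sa s" "s * s = x" "norm (of_real (sqrt c) - s) \<le> sqrt c"
    "\<And>y. y * x = x * y \<Longrightarrow> y * s = s * y"
proof (cases "c = 0")
  case True
  with assms have "x = 0" by simp
  then show thesis by (intro that[of 0]) (use assms True in \<open>simp_all add: A_sa_simps\<close>)
next
  case False
  with assms(2) have c: "c > 0" using norm_ge_zero[of "of_real c - x"] by linarith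
  define z where "z = 1 - (1/c) *\<^sub>R x"
  have z: "z = (1/c) *\<^sub>R (of_real c - x)"
  proof -
    have "(1/c) *\<^sub>R of_real c = (1::'a)" using c by (simp add: of_real_def)
    then show ?thesis by (simp only: z_def scaleR_diff_right)
  qed
  have "A_sa z" using assms(1) by (simp add: z_def A_sa_simps)
  moreover have "norm z \<le> 1" using assms(2) c by (simp only: z norm_scaleR) (simp add: field_simps)
  ultimately obtain s where s: "A_sa s" "s * s = 1 - z" "norm (1 - s) \<le> 1"
      "\<And>y. y * z = z * y \<Longrightarrow> y * s = s * y"
    by (rule sqrt_one_minus_exists) (rule that)
  show thesis
  proof
    show "A_sa (sqrt c *\<^sub>R s)" using s(1) by (simp add: A_sa_simps)
    show "(sqrt c *\<^sub>R s) * (sqrt c *\<^sub>R s) = x"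
      using c by (simp add: s(2) z_def)
    have "of_real (sqrt c) - sqrt c *\<^sub>R s = sqrt c *\<^sub>R (1 - s)"
      by (simp add: of_real_def scaleR_diff_right)
    then show "norm (of_real (sqrt c) - sqrt c *\<^sub>R s) \<le> sqrt c"
      using s(3) c by (simp add: mult_left_le)
    fix y assume "y * x = x * y"
    then have "y * z = z * y" by (simp add: z_def algebra_simps)
    then show "y * (sqrt c *\<^sub>R s) = (sqrt c *\<^sub>R s) * y" using s(4) by simp
  qed
qed

lemma sa_square_if_norm_le:
  "A_sa x \<Longrightarrow> norm (of_real c - x) \<le> c \<Longrightarrow> sa_square x"
  by (metis sqrt_exists_if_norm_le sa_square_def)

lemma A_sa_if_sa_square: "sa_square x \<Longrightarrow> A_sa x"
  by (auto simp: sa_square_def A_sa_simps)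

text \<open>\<open>s\<close> is the real part of \<open>u = s + i t\<close>, and commutation makes
  \<open>adj u * u\<close> equal to \<open>s * s + t * t\<close>.\<close>

lemma norm_le_if_commuting_sa:
  fixes s t :: "'a::cstar_algebra"
  assumes "A_sa s" "A_sa t" "s * t = t * s"
  shows "norm s * norm s \<le> norm (s * s + t * t)"
proof -
  define u where "u = s + scaleC \<i> t"
  have au: "adj u = s - scaleC \<i> t"
    using assms by (simp add: u_def adj_add adj_scaleC A_sa_def scaleC_minus_left)
  have "adj u * u = s * s + t * t"
  proof -
    have "adj u * u = s * s + s * scaleC \<i> t - (scaleC \<i> t * s + scaleC \<i> t * scaleC \<i> t)"
      unfolding au by (simp only: u_def distrib_left left_diff_distrib) (simp add: algebra_simps)
    then show ?thesis
      by (simp add: scaleC_mult_left scaleC_mult_right assms(3) scaleC_scaleC scaleC_minus_left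
          scaleC_one)
  qed
  then have nu: "norm u * norm u = norm (s * s + t * t)" by (metis cstar_identity)
  have "2 *\<^sub>R s = u + adj u" by (simp add: au) (simp add: u_def scaleR_2)
  then have "norm (2 *\<^sub>R s) \<le> norm u + norm (adj u)" by (metis norm_triangle_ineq)
  then have "norm s \<le> norm u" by (simp add: norm_adj)
  then have "norm s * norm s \<le> norm u * norm u" by (intro mult_mono) auto
  then show ?thesis using nu by simp
qed

text \<open>Converse of the norm test. The element \<open>c - x\<close> passes the test because
  \<open>x\<close> has norm at most \<open>c\<close>; its root \<open>t\<close> commutes with the
  root \<open>s\<close> of \<open>x\<close>, and \<open>t * t + s * s = c\<close> bounds
  \<open>norm t\<close>.\<close>

lemma norm_diff_le_if_sa_square:
  fixes x :: "'a::cstar_algebra"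
  assumes "sa_square x" "norm x \<le> c"
  shows "norm (of_real c - x) \<le> c"
proof -
  obtain s where s: "A_sa s" "x = s * s" using assms(1) by (auto simp: sa_square_def)
  have "A_sa (of_real c - x)" "norm (of_real c - (of_real c - x)) \<le> c"
    using assms A_sa_if_sa_square[OF assms(1)] by (simp_all add: A_sa_simps)
  then obtain t where t: "A_sa t" "t * t = of_real c - x"
      "\<And>y. y * (of_real c - x) = (of_real c - x) * y \<Longrightarrow> y * t = t * y"
    by (rule sqrt_exists_if_norm_le) (rule that)
  have "s * (of_real c - x) = (of_real c - x) * s"
    by (simp add: s algebra_simps of_real_def)
  then have "s * t = t * s" by (rule t)
  then have "norm t * norm t \<le> norm (t * t + s * s)"
    using norm_le_if_commuting_sa t(1) s(1) by metis
  also have "t * t + s * s = of_real c" by (simp add: t(2) s(2))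
  also have "norm (of_real c :: 'a) = c"
    using order_trans[OF norm_ge_zero assms(2)] by simp
  finally show ?thesis using norm_mult_self[OF t(1)] t(2) by simp
qed

text \<open>Two norm tests with radii \<open>norm x\<close> and \<open>norm y\<close> add up to one
  with the sum of the radii.\<close>

lemma sa_square_add:
  fixes x y :: "'a::cstar_algebra"
  assumes "sa_square x" "sa_square y"
  shows "sa_square (x + y)"
proof (rule sa_square_if_norm_le[where c="norm x + norm y"])
  show "A_sa (x + y)" using assms by (simp add: A_sa_if_sa_square A_sa_simps)
  have "of_real (norm x + norm y) - (x + y)
      = (of_real (norm x) - x) + (of_real (norm y) - y)" by simp
  also have "norm \<dots> \<le> norm x + norm y"
    by (intro norm_triangle_le add_mono norm_diff_le_if_sa_square assms) auto
  finally show "norm (of_real (norm x + norm y) - (x + y)) \<le> norm x + norm y" .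
qed

lemma sa_square_scaleR:
  assumes "sa_square x" "0 \<le> r"
  shows "sa_square (r *\<^sub>R x)"
proof -
  obtain s where s: "A_sa s" "x = s * s" using assms(1) by (auto simp: sa_square_def)
  show ?thesis unfolding sa_square_def
    by (rule exI[of _ "sqrt r *\<^sub>R s"]) (use s assms(2) in \<open>simp add: A_sa_simps\<close>)
qed

lemma sa_square_of_real: "0 \<le> r \<Longrightarrow> sa_square (of_real r :: 'a::cstar_algebra)"
  by (rule sa_square_if_norm_le[where c=r]) (simp_all add: A_sa_simps)

text \<open>With one constant \<open>c\<close> bounding the whole sequence, the norm test is a
  closed condition.\<close>

lemma sa_square_limit:
  fixes x :: "nat \<Rightarrow> 'a::cstar_algebra"
  assumes x: "x \<longlonglongrightarrow> l" and sq: "\<And>n. sa_square (x n)"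
  shows "sa_square l"
proof -
  obtain c where c: "\<And>n. norm (x n) \<le> c"
    using convergent_imp_Bseq[of x] x by (auto simp: convergent_def Bseq_def)
  have "(\<lambda>n. norm (of_real c - x n)) \<longlonglongrightarrow> norm (of_real c - l)"
    by (intro tendsto_intros x)
  then have "norm (of_real c - l) \<le> c"
    by (rule LIMSEQ_le_const2) (use norm_diff_le_if_sa_square[OF sq c] in blast)
  then show ?thesis
    using sa_square_if_norm_le A_sa_limit[OF x A_sa_if_sa_square[OF sq]] by metis
qed

lemma sa_square_of_real_diff:
  fixes x :: "'a::cstar_algebra"
  assumes "A_sa x" "norm x \<le> c"
  shows "sa_square (of_real c - x)"
  by (rule sa_square_if_norm_le[where c=c]) (use assms in \<open>simp_all add: A_sa_simps\<close>)

lemma sa_square_sqrt: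
  fixes x :: "'a::cstar_algebra"
  assumes "sa_square x"
  obtains s where "A_sa s" "sa_square s" "s * s = x" "\<And>y. y * x = x * y \<Longrightarrow> y * s = s * y"
proof -
  have "norm (of_real (norm x) - x) \<le> norm x"
    by (rule norm_diff_le_if_sa_square[OF assms]) simp
  with A_sa_if_sa_square[OF assms] show thesis
    by (rule sqrt_exists_if_norm_le) (use that sa_square_if_norm_le in blast)
qed

lemma norm_le_if_sa_square_diff:
  fixes x :: "'a::cstar_algebra"
  assumes "sa_square x" "sa_square (of_real c - x)"
  shows "norm x \<le> \<bar>c\<bar>"
proof -
  obtain s where s: "A_sa s" "x = s * s" using assms(1) by (auto simp: sa_square_def)
  obtain t where t: "A_sa t" "t * t = of_real c - x"
      "\<And>y. y * (of_real c - x) = (of_real c - x) * y \<Longrightarrow> y * t = t * y"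
    by (rule sa_square_sqrt[OF assms(2)]) (rule that)
  have "s * (of_real c - x) = (of_real c - x) * s"
    by (simp add: s algebra_simps of_real_def)
  then have "s * t = t * s" by (rule t)
  then have "norm s * norm s \<le> norm (s * s + t * t)"
    by (rule norm_le_if_commuting_sa[OF s(1) t(1)])
  also have "s * s + t * t = of_real c" by (simp add: t(2) s(2))
  finally show ?thesis using norm_mult_self[OF s(1)] s(2) by simp
qed

lemma sa_square_antisym:
  fixes x :: "'a::cstar_algebra"
  assumes "sa_square x" "sa_square (- x)"
  shows "x = 0"
  using norm_le_if_sa_square_diff[of x 0] assms by simp

section \<open>Invertibility and Kaplansky's theorem\<close>

lemma invertible_of_norm_less:
  fixes x :: "'a::cstar_algebra"
  assumes "norm (1 - x) < 1"
  obtains y where "x * y = 1" "y * x = 1"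
proof -
  define z where "z = 1 - x"
  have "summable (\<lambda>n. norm z ^ n)" using assms by (intro summable_geometric) (simp add: z_def)
  then have s: "summable (\<lambda>n. z ^ n)"
    by (rule summable_comparison_test') (rule norm_power_ineq)
  have e: "(\<Sum>n. z ^ n) = 1 + (\<Sum>n. z ^ Suc n)"
    using suminf_split_head[OF s] by simp
  have l: "(\<Sum>n. z ^ Suc n) = z * (\<Sum>n. z ^ n)"
    by (simp add: suminf_mult[OF s])
  have r: "(\<Sum>n. z ^ Suc n) = (\<Sum>n. z ^ n) * z"
    unfolding power_Suc2 by (rule suminf_mult2[OF s, symmetric])
  have x: "x = 1 - z" by (simp add: z_def)
  show thesis
  proof
    show "x * (\<Sum>n. z ^ n) = 1" using e l by (simp add: x algebra_simps)
    show "(\<Sum>n. z ^ n) * x = 1" using e r by (simp add: x algebra_simps)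
  qed
qed

text \<open>Division by \<open>c = l + norm k\<close> brings the element within
  \<open>norm k / c < 1\<close> of \<open>1\<close>, in reach of the Neumann series.\<close>

lemma invertible_of_real_add:
  fixes k :: "'a::cstar_algebra"
  assumes "sa_square k" "0 < l"
  obtains y where "(of_real l + k) * y = 1" "y * (of_real l + k) = 1"
proof -
  define c where "c = l + norm k"
  have c: "c > 0" using assms(2) by (simp add: c_def add_pos_nonneg)
  have "1 - (1/c) *\<^sub>R (of_real l + k) = (1/c) *\<^sub>R (of_real (norm k) - k)"
  proof -
    have "(1::'a) = (1/c) *\<^sub>R of_real c" using c by (simp add: of_real_def)
    then have "1 - (1/c) *\<^sub>R (of_real l + k) = (1/c) *\<^sub>R (of_real c - (of_real l + k))"
      by (simp add: scaleR_diff_right)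
    then show ?thesis by (simp add: c_def)
  qed
  moreover have "norm (of_real (norm k) - k) \<le> norm k"
    by (intro norm_diff_le_if_sa_square assms) simp
  moreover have "norm k < c" using assms(2) by (simp add: c_def)
  ultimately have "norm (1 - (1/c) *\<^sub>R (of_real l + k)) < 1"
    using c by (simp only: norm_scaleR) (simp add: divide_simps)
  then obtain y where "(1/c) *\<^sub>R (of_real l + k) * y = 1" "y * ((1/c) *\<^sub>R (of_real l + k)) = 1"
    by (rule invertible_of_norm_less)
  then show thesis by (intro that[of "(1/c) *\<^sub>R y"]) simp_all
qed

text \<open>Equivalently: the norm of a positive element lies in its spectrum.\<close>

lemma norm_not_resolvent:
  fixes h :: "'a::cstar_algebra"
  assumes h: "sa_square h" and "h \<noteq> 0"
    and y: "(of_real (norm h) - h) * y = 1" "y * (of_real (norm h) - h) = 1"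
  shows False
proof -
  define g where "g = of_real (norm h) - h"
  have sq: "sa_square g"
    unfolding g_def by (rule sa_square_of_real_diff) (simp_all add: A_sa_if_sa_square h)
  then obtain s where s: "A_sa s" "s * s = g" by (metis sa_square_def)
  have gy: "g * y = 1" "y * g = 1" using y by (simp_all add: g_def)
  have sag: "adj g = g" using A_sa_if_sa_square[OF sq] by (simp add: A_sa_def)
  have "adj y * g = adj (g * y)" by (simp add: adj_mult sag)
  then have "adj y * g = 1" using gy by simp
  then have say: "A_sa y" unfolding A_sa_def by (metis gy(1) mult.assoc mult_1_left mult_1_right)
  have "sa_square (of_real (norm y) - y)"
    by (rule sa_square_of_real_diff) (use say in simp_all)
  then obtain r where r: "A_sa r" "r * r = of_real (norm y) - y"
    "\<And>x. x * (of_real (norm y) - y) = (of_real (norm y) - y) * x \<Longrightarrow> x * r = r * x"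
    by (rule sa_square_sqrt) (rule that)
  have sg: "s * g = g * s" by (simp add: mult.assoc flip: s(2))
  have "s * y = y * g * (s * y)" by (simp add: gy)
  also have "\<dots> = y * (s * g) * y" by (simp add: sg mult.assoc)
  also have "\<dots> = y * s" by (simp add: gy mult.assoc)
  finally have sy: "s * y = y * s" .
  then have sr: "s * r = r * s" by (intro r(3)) (simp add: algebra_simps of_real_def)
  \<comment> \<open>Multiplying the positive element \<open>norm y - y\<close> by \<open>g\<close>
    gives \<open>norm y * g - 1\<close>, still a square because the roots commute: boundedness of
    the inverse keeps \<open>g\<close> above \<open>1 / norm y\<close>.\<close>
  have "(r * s) * (r * s) = (r * r) * (s * s)" by (metis sr mult.assoc)
  also have "\<dots> = norm y *\<^sub>R g - 1"
    by (simp add: r(2) s(2) gy left_diff_distrib of_real_def)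
  finally have eq: "norm y *\<^sub>R g - 1 = (r * s) * (r * s)" by simp
  have "A_sa (r * s)" using r(1) s(1) sr by (simp add: A_sa_def adj_mult)
  then have "sa_square (norm y *\<^sub>R g - 1)" using eq by (auto simp: sa_square_def)
  moreover have ny: "norm y > 0" using gy by auto
  ultimately have "sa_square ((1 / norm y) *\<^sub>R (norm y *\<^sub>R g - 1))"
    by (intro sa_square_scaleR) auto
  also have "(1 / norm y) *\<^sub>R (norm y *\<^sub>R g - 1) = of_real (norm h - 1 / norm y) - h"
    using ny by (simp add: scaleR_diff_right g_def of_real_def scaleR_left_diff_distrib)
  finally have *: "sa_square (of_real (norm h - 1 / norm y) - h)" .
  \<comment> \<open>Now \<open>h\<close> lies below the constant \<open>norm h - 1 / norm y\<close>.
    If that is nonnegative, \<open>norm h\<close> would be smaller than itself; if negative,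
    \<open>- h\<close> is positive as well and \<open>h\<close> vanishes.\<close>
  show False
  proof (cases "norm h - 1 / norm y \<ge> 0")
    case True
    then show False using norm_le_if_sa_square_diff[OF h *] ny by simp
  next
    case False
    then have "sa_square (of_real (1 / norm y - norm h) :: 'a)"
      by (intro sa_square_of_real) simp
    from sa_square_add[OF this *] have "sa_square (- h)" by simp
    then show False using sa_square_antisym[OF h] assms(2) by simp
  qed
qed

text \<open>The identity behind the agreement of the nonzero spectra of \<open>a b\<close> and
  \<open>b a\<close>: if \<open>v\<close> inverts \<open>l + w * adj w\<close>, then
  \<open>(1 - adj w * v * w) / l\<close> inverts \<open>l + adj w * w\<close>. For
  \<open>h = - (adj w * w)\<close> and \<open>l = norm h\<close>, \<open>norm_not_resolvent\<close>
  forbids such an inverse.\<close>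

lemma eq_0_if_opposite_squares:
  fixes w :: "'a::cstar_algebra"
  assumes h: "sa_square (- (adj w * w))" and k: "sa_square (w * adj w)"
  shows "w = 0"
proof (rule ccontr)
  define h where "h = - (adj w * w)"
  assume "w \<noteq> 0"
  then have h0: "h \<noteq> 0" by (simp add: h_def adj_mult_self_eq_0)
  define l where "l = norm h"
  have l: "l > 0" using h0 by (simp add: l_def)
  obtain v where v: "(of_real l + w * adj w) * v = 1" "v * (of_real l + w * adj w) = 1"
    by (rule invertible_of_real_add[OF k l])
  have v1: "w * adj w * v = 1 - l *\<^sub>R v" using v(1) by (simp add: algebra_simps of_real_def)
  have v2: "v * w * adj w = 1 - l *\<^sub>R v" using v(2) by (simp add: algebra_simps of_real_def)
  define y where "y = (1/l) *\<^sub>R (1 - adj w * v * w)"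
  have "(of_real l - h) * y = (1/l) *\<^sub>R (l *\<^sub>R 1 + adj w * w - l *\<^sub>R (adj w * v * w)
      - adj w * (w * adj w * v) * w)"
    by (simp add: y_def h_def of_real_def algebra_simps)
  also have "\<dots> = 1" unfolding v1 using l by (simp add: algebra_simps)
  finally have y1: "(of_real l - h) * y = 1" .
  have "y * (of_real l - h) = (1/l) *\<^sub>R (l *\<^sub>R 1 + adj w * w - l *\<^sub>R (adj w * v * w)
      - adj w * (v * w * adj w) * w)"
    by (simp add: y_def h_def of_real_def algebra_simps)
  also have "\<dots> = 1" unfolding v2 using l by (simp add: algebra_simps)
  finally have y2: "y * (of_real l - h) = 1" .
  show False using norm_not_resolvent[of h y] h0 y1 y2 h by (simp add: h_def l_def)
qed

text \<open>\<open>w\<^sup>* w + w w\<^sup>*\<close> is twice the sum of the squares of the real and imaginary parts.\<close>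

lemma sa_square_add_adj_squares:
  fixes w :: "'a::cstar_algebra"
  shows "sa_square (adj w * w + w * adj w)"
proof -
  define a where "a = w + adj w"
  define b where "b = scaleC \<i> (w - adj w)"
  have sa: "A_sa a" "A_sa b"
    by (simp_all add: A_sa_def a_def b_def adj_add adj_adj adj_scaleC adj_diff scaleC_minus_left
        scaleC_diff_right)
  have bb: "b * b = - ((w - adj w) * (w - adj w))"
    by (simp add: b_def scaleC_mult_left scaleC_mult_right scaleC_scaleC scaleC_minus_left scaleC_one)
  have "2 *\<^sub>R (adj w * w + w * adj w) = a * a + b * b"
    unfolding bb by (simp add: a_def algebra_simps scaleR_2)
  moreover have "sa_square (a * a + b * b)"
    using sa by (intro sa_square_add) (auto simp: sa_square_def)
  ultimately have "sa_square (2 *\<^sub>R (adj w * w + w * adj w))" by (simp only:)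
  from sa_square_scaleR[OF this, of "1/2"] show ?thesis by simp
qed

text \<open>For \<open>w = y * g\<close>, the product \<open>adj w * w = g * x * g\<close> is minus
  a square. As \<open>adj w * w + w * adj w\<close> is positive, so is \<open>w * adj w\<close>,
  which forces \<open>w = 0\<close>; then the negative part of \<open>x\<close> vanishes.\<close>

theorem sa_square_adj_mult_self:
  fixes y :: "'a::cstar_algebra"
  shows "sa_square (adj y * y)"
proof -
  define x where "x = adj y * y"
  have sax: "A_sa x" by (simp add: x_def A_sa_simps)
  then have "sa_square (x * x)" by (auto simp: sa_square_def)
  text \<open>\<open>m\<close> is the absolute value of \<open>x\<close>, and \<open>g\<close> is twice its negative part.\<close>
  then obtain m where m: "A_sa m" "sa_square m" "m * m = x * x"
      "\<And>y. y * (x * x) = (x * x) * y \<Longrightarrow> y * m = m * y"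
    by (rule sa_square_sqrt) (rule that)
  have xm: "x * m = m * x" by (rule m(4)) (simp add: mult.assoc)
  obtain r where r: "A_sa r" "r * r = m" "\<And>y. y * m = m * y \<Longrightarrow> y * r = r * y"
    by (rule sa_square_sqrt[OF m(2)]) (rule that)
  define g where "g = m - x"
  have sag: "A_sa g" using m(1) sax by (simp add: g_def A_sa_simps)
  have xg: "x * g = - (m * g)"
    by (simp add: g_def right_diff_distrib xm m(3))
  have gm: "g * m = m * g" by (simp add: g_def left_diff_distrib right_diff_distrib xm)
  have gr: "g * r = r * g" by (rule r(3)) (rule gm)
  have sarg: "A_sa (r * g)" using r(1) sag gr by (simp add: A_sa_def adj_mult)
  define w where "w = y * g"
  have "adj w * w = g * (x * g)" using sag by (simp add: w_def adj_mult A_sa_def x_def mult.assoc)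
  also have "\<dots> = - ((r * g) * (r * g))"
    unfolding xg by (metis r(2) gr mult.assoc mult_minus_right)
  finally have ww: "- (adj w * w) = (r * g) * (r * g)" by simp
  then have neg: "sa_square (- (adj w * w))" using sarg by (auto simp: sa_square_def)
  have "sa_square ((adj w * w + w * adj w) + - (adj w * w))"
    by (intro sa_square_add neg sa_square_add_adj_squares)
  then have "w = 0" using eq_0_if_opposite_squares[OF neg] by simp
  then have "norm (r * g) * norm (r * g) = 0" using norm_mult_self[OF sarg] ww by simp
  then have "r * g = 0" by simp
  then have mg: "m * g = 0" by (simp add: mult.assoc flip: r(2))
  have "g * g = m * g - x * g" by (simp add: g_def left_diff_distrib)
  also have "\<dots> = 0" by (simp add: xg mg)
  finally have "norm g * norm g = 0" using norm_mult_self[OF sag] by simp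
  then have "m = x" by (simp add: g_def)
  then show ?thesis using m(2) by (simp add: x_def)
qed

section \<open>The order of \<open>A\<close> and norm bounds derived from it\<close>

lemma A_pos_iff_sa_square: "A_pos x \<longleftrightarrow> sa_square x"
proof
  assume "sa_square x"
  then obtain s where "A_sa s" "x = s * s" by (auto simp: sa_square_def)
  then have "x = adj s * s" by (simp add: A_sa_def)
  then show "A_pos x" by (auto simp: A_pos_def)
qed (auto simp: A_pos_def sa_square_adj_mult_self)

lemma A_pos_adj_mult_self: "A_pos (adj y * y)"
  by (auto simp: A_pos_def)

lemma A_pos_0 [simp]: "A_pos 0"
  using A_pos_adj_mult_self[of 0] by simp

lemma A_pos_add: "A_pos x \<Longrightarrow> A_pos y \<Longrightarrow> A_pos (x + y)"
  by (simp add: A_pos_iff_sa_square sa_square_add)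

lemma A_pos_sum: "(\<And>i. i \<in> I \<Longrightarrow> A_pos (f i)) \<Longrightarrow> A_pos (sum f I)"
  by (induction I rule: infinite_finite_induct) (simp_all add: A_pos_add)

lemma A_pos_scaleR: "A_pos x \<Longrightarrow> 0 \<le> r \<Longrightarrow> A_pos (r *\<^sub>R x)"
  by (simp add: A_pos_iff_sa_square sa_square_scaleR)

lemma A_sa_if_A_pos: "A_pos x \<Longrightarrow> A_sa x"
  by (simp add: A_pos_iff_sa_square A_sa_if_sa_square)

lemma A_pos_limit:
  fixes x :: "nat \<Rightarrow> 'a::cstar_algebra"
  shows "x \<longlonglongrightarrow> l \<Longrightarrow> (\<And>n. A_pos (x n)) \<Longrightarrow> A_pos l"
  by (simp add: A_pos_iff_sa_square sa_square_limit)

lemma A_pos_if_arbitrarily_close: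
  fixes x :: "'a::cstar_algebra"
  assumes "\<And>e. 0 < e \<Longrightarrow> \<exists>y. A_pos y \<and> norm (y - x) \<le> e"
  shows "A_pos x"
proof -
  have "\<forall>n. \<exists>y. A_pos y \<and> norm (y - x) \<le> inverse (real (Suc n))" using assms by simp
  then obtain y where y: "\<And>n. A_pos (y n)" "\<And>n. norm (y n - x) \<le> inverse (real (Suc n))"
    by metis
  have "(\<lambda>n. y n - x) \<longlonglongrightarrow> 0"
    by (rule Lim_null_comparison[OF _ LIMSEQ_inverse_real_of_nat]) (use y in auto)
  then have "y \<longlonglongrightarrow> x" by (simp add: LIM_zero_iff)
  then show ?thesis using y(1) by (rule A_pos_limit)
qed

lemma A_pos_conj: "A_pos x \<Longrightarrow> A_pos (adj a * x * a)"
  by (metis A_pos_def adj_mult mult.assoc)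

lemma A_pos_antisym: "A_pos x \<Longrightarrow> A_pos (- x) \<Longrightarrow> x = 0"
  by (simp add: A_pos_iff_sa_square sa_square_antisym)

lemma A_pos_of_real_diff: "A_sa x \<Longrightarrow> norm x \<le> c \<Longrightarrow> A_pos (of_real c - x)"
  by (simp add: A_pos_iff_sa_square sa_square_of_real_diff)

text \<open>Conjugating \<open>c + x\<close> by the root \<open>r\<close> of \<open>c - x\<close>
  yields \<open>c^2 - x^2\<close>, which reduces the two-sided bound to one on the positive element
  \<open>x * x\<close>.\<close>

lemma norm_le_if_A_pos:
  fixes x :: "'a::cstar_algebra"
  assumes "A_pos (of_real c - x)" "A_pos (of_real c + x)" "0 \<le> c"
  shows "norm x \<le> c"
proof -
  have sa: "A_sa x"
    using A_sa_simps(5)[OF A_sa_if_A_pos[OF assms(2)] A_sa_simps(3)[of c]] by simp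
  obtain r where r: "A_sa r" "r * r = of_real c - x"
      "\<And>y. y * (of_real c - x) = (of_real c - x) * y \<Longrightarrow> y * r = r * y"
    using assms(1) unfolding A_pos_iff_sa_square by (rule sa_square_sqrt) (rule that)
  have "(of_real c + x) * r = r * (of_real c + x)"
    by (rule r(3)) (simp add: algebra_simps of_real_def)
  then have "adj r * (of_real c + x) * r = (of_real c - x) * (of_real c + x)"
    using r(1) by (simp add: A_sa_def mult.assoc flip: r(2))
  also have "\<dots> = of_real (c * c) - x * x" by (simp add: algebra_simps of_real_def)
  finally have "sa_square (of_real (c * c) - x * x)"
    using A_pos_conj[OF assms(2), of r] by (simp add: A_pos_iff_sa_square)
  then have "norm (x * x) \<le> \<bar>c * c\<bar>"
    using sa by (intro norm_le_if_sa_square_diff) (auto simp: sa_square_def)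
  then have "norm x * norm x \<le> c * c" by (simp add: norm_mult_self[OF sa])
  then show ?thesis
    using assms(3) by (metis abs_le_square_iff abs_of_nonneg norm_ge_zero power2_eq_square)
qed

lemma norm_le_if_A_pos_le:
  assumes "A_pos x" "A_pos (of_real c - x)"
  shows "norm x \<le> \<bar>c\<bar>"
  using assms by (simp add: A_pos_iff_sa_square norm_le_if_sa_square_diff)

lemma A_le_refl [simp]: "A_le x x" by (simp add: A_le_def)

lemma A_le_trans [trans]: "A_le x y \<Longrightarrow> A_le y z \<Longrightarrow> A_le x z"
  unfolding A_le_def using A_pos_add[of "y - x" "z - y"] by simp

lemma A_le_antisym: "A_le x y \<Longrightarrow> A_le y x \<Longrightarrow> x = y"
  unfolding A_le_def using A_pos_antisym[of "y - x"] by simp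

lemma A_le_add: "A_le x y \<Longrightarrow> A_le z w \<Longrightarrow> A_le (x + z) (y + w)"
  unfolding A_le_def using A_pos_add[of "y - x" "w - z"] by (simp add: algebra_simps)

lemma A_le_scaleR: "A_le x y \<Longrightarrow> 0 \<le> r \<Longrightarrow> A_le (r *\<^sub>R x) (r *\<^sub>R y)"
  unfolding A_le_def using A_pos_scaleR[of "y - x" r] by (simp add: scaleR_diff_right)

lemma A_is_sup_unique: "A_is_sup s x \<Longrightarrow> A_is_sup s y \<Longrightarrow> x = y"
  by (simp add: A_is_sup_def A_le_antisym)

text \<open>Since the weights sum to \<open>1\<close>, the constant \<open>e\<close> can be
  distributed over them and compared termwise with \<open>a i\<close>. Asking for the bound on
  \<open>a i\<close> only at nonzero weights accommodates pairs of partition pieces with meet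
  \<open>bot\<close>.\<close>

lemma norm_sum_scaleR_le:
  fixes m :: "'i \<Rightarrow> 'a::cstar_algebra"
  assumes pos: "\<And>i. i \<in> I \<Longrightarrow> A_pos (m i)" and one: "sum m I = 1"
    and a: "\<And>i. i \<in> I \<Longrightarrow> m i \<noteq> 0 \<Longrightarrow> \<bar>a i\<bar> \<le> e" and e: "0 \<le> e"
  shows "norm (\<Sum>i\<in>I. a i *\<^sub>R m i) \<le> e"
proof (rule norm_le_if_A_pos[OF _ _ e])
  have c: "of_real e = (\<Sum>i\<in>I. e *\<^sub>R m i)"
    by (simp add: one of_real_def flip: scaleR_sum_right)
  have "of_real e - (\<Sum>i\<in>I. a i *\<^sub>R m i) = (\<Sum>i\<in>I. (e - a i) *\<^sub>R m i)"
    by (simp add: c sum_subtractf scaleR_left_diff_distrib)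
  moreover have "A_pos ((e - a i) *\<^sub>R m i)" if "i \<in> I" for i
    using a[OF that] pos[OF that] by (cases "m i = 0") (auto intro!: A_pos_scaleR)
  ultimately show "A_pos (of_real e - (\<Sum>i\<in>I. a i *\<^sub>R m i))" by (simp add: A_pos_sum)
  have "of_real e + (\<Sum>i\<in>I. a i *\<^sub>R m i) = (\<Sum>i\<in>I. (e + a i) *\<^sub>R m i)"
    by (simp add: c sum.distrib scaleR_left_distrib)
  moreover have "A_pos ((e + a i) *\<^sub>R m i)" if "i \<in> I" for i
    using a[OF that] pos[OF that] by (cases "m i = 0") (auto intro!: A_pos_scaleR)
  ultimately show "A_pos (of_real e + (\<Sum>i\<in>I. a i *\<^sub>R m i))" by (simp add: A_pos_sum)
qed

lemma scaleC_eq_scaleR: "scaleC c x = Re c *\<^sub>R x + scaleC \<i> (Im c *\<^sub>R x)"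
  by (metis complex_eq scaleC_add_left scaleC_of_real scaleC_scaleC)

text \<open>Real and imaginary parts are estimated separately; this is the origin of the factor 2 in
  all bounds on Riemann sums.\<close>

lemma norm_sum_scaleC_le:
  fixes m :: "'i \<Rightarrow> 'a::cstar_algebra"
  assumes pos: "\<And>i. i \<in> I \<Longrightarrow> A_pos (m i)" and one: "sum m I = 1"
    and a: "\<And>i. i \<in> I \<Longrightarrow> m i \<noteq> 0 \<Longrightarrow> cmod (a i) \<le> e" and e: "0 \<le> e"
  shows "norm (\<Sum>i\<in>I. scaleC (a i) (m i)) \<le> 2 * e"
proof -
  have "(\<Sum>i\<in>I. scaleC (a i) (m i))
      = (\<Sum>i\<in>I. Re (a i) *\<^sub>R m i) + scaleC \<i> (\<Sum>i\<in>I. Im (a i) *\<^sub>R m i)"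
    by (simp add: scaleC_eq_scaleR[of "a _"] sum.distrib scaleC_sum_right)
  also have "norm \<dots> \<le> e + e"
  proof (intro norm_triangle_le add_mono)
    show "norm (\<Sum>i\<in>I. Re (a i) *\<^sub>R m i) \<le> e"
      using a abs_Re_le_cmod order_trans by (intro norm_sum_scaleR_le pos one e) blast+
    have "norm (\<Sum>i\<in>I. Im (a i) *\<^sub>R m i) \<le> e"
      using a abs_Im_le_cmod order_trans by (intro norm_sum_scaleR_le pos one e) blast+
    then show "norm (scaleC \<i> (\<Sum>i\<in>I. Im (a i) *\<^sub>R m i)) \<le> e" by (simp add: norm_scaleC)
  qed
  finally show ?thesis by simp
qed

section \<open>Positive matrices\<close>

definition mat_mul ::
  "nat \<Rightarrow> (nat \<Rightarrow> nat \<Rightarrow> 'a) \<Rightarrow> (nat \<Rightarrow> nat \<Rightarrow> 'a) \<Rightarrow> nat \<Rightarrow> nat \<Rightarrow> 'a::cstar_algebra" where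
  "mat_mul n S R = (\<lambda>i j. \<Sum>k<n. S i k * R k j)"

definition mat_vec :: "nat \<Rightarrow> (nat \<Rightarrow> nat \<Rightarrow> 'a) \<Rightarrow> (nat \<Rightarrow> 'a) \<Rightarrow> nat \<Rightarrow> 'a::cstar_algebra" where
  "mat_vec n S x = (\<lambda>i. \<Sum>j<n. S i j * x j)"

definition vec_ip :: "nat \<Rightarrow> (nat \<Rightarrow> 'a) \<Rightarrow> (nat \<Rightarrow> 'a) \<Rightarrow> 'a::cstar_algebra" where
  "vec_ip n x y = (\<Sum>i<n. adj (x i) * y i)"

text \<open>For nonnegative \<open>r\<close>: \<open>S\<close> has norm at most \<open>r\<close> as
  an operator on the Hilbert module \<open>A^n\<close>. The \<open>A\<close>-valued form makes this
  composable by transitivity of \<open>A_le\<close>.\<close>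

definition op_bound :: "nat \<Rightarrow> (nat \<Rightarrow> nat \<Rightarrow> 'a::cstar_algebra) \<Rightarrow> real \<Rightarrow> bool" where
  "op_bound n S r \<longleftrightarrow>
     (\<forall>x. A_le (vec_ip n (mat_vec n S x) (mat_vec n S x)) (r\<^sup>2 *\<^sub>R vec_ip n x x))"

lemma mat_vec_mul: "mat_vec n (mat_mul n S R) x = mat_vec n S (mat_vec n R x)"
proof
  fix i
  have "mat_vec n (mat_mul n S R) x i = (\<Sum>j<n. \<Sum>k<n. S i k * (R k j * x j))"
    by (simp add: mat_vec_def mat_mul_def sum_distrib_right mult.assoc)
  also have "\<dots> = (\<Sum>k<n. \<Sum>j<n. S i k * (R k j * x j))" by (rule sum.swap)
  finally show "mat_vec n (mat_mul n S R) x i = mat_vec n S (mat_vec n R x) i"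
    by (simp add: mat_vec_def sum_distrib_left)
qed

lemma mat_vec_add: "mat_vec n (\<lambda>i j. S i j + R i j) x = (\<lambda>i. mat_vec n S x i + mat_vec n R x i)"
  by (simp add: mat_vec_def distrib_right sum.distrib)

lemma mat_vec_scaleR: "mat_vec n (\<lambda>i j. r *\<^sub>R S i j) x = (\<lambda>i. r *\<^sub>R mat_vec n S x i)"
  by (simp add: mat_vec_def scaleR_sum_right)

lemma mat_vec_diff_right:
  "mat_vec n S (\<lambda>i. x i - y i) = (\<lambda>i. mat_vec n S x i - mat_vec n S y i)"
  by (simp add: mat_vec_def right_diff_distrib sum_subtractf)

lemma vec_ip_cong:
  "(\<And>i. i < n \<Longrightarrow> x i = x' i) \<Longrightarrow> (\<And>i. i < n \<Longrightarrow> y i = y' i) \<Longrightarrow> vec_ip n x y = vec_ip n x' y'"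
  by (simp add: vec_ip_def)

lemma vec_ip_simps:
  "vec_ip n (\<lambda>i. x i + y i) z = vec_ip n x z + vec_ip n y z"
  "vec_ip n z (\<lambda>i. x i + y i) = vec_ip n z x + vec_ip n z y"
  "vec_ip n (\<lambda>i. x i - y i) z = vec_ip n x z - vec_ip n y z"
  "vec_ip n z (\<lambda>i. x i - y i) = vec_ip n z x - vec_ip n z y"
  "vec_ip n (\<lambda>i. r *\<^sub>R x i) z = r *\<^sub>R vec_ip n x z"
  "vec_ip n z (\<lambda>i. r *\<^sub>R x i) = r *\<^sub>R vec_ip n z x"
  by (simp_all add: vec_ip_def adj_add adj_diff adj_scaleR distrib_left distrib_right
      left_diff_distrib right_diff_distrib sum.distrib sum_subtractf scaleR_sum_right)

lemma A_pos_vec_ip: "A_pos (vec_ip n x x)"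
  by (simp add: vec_ip_def A_pos_sum A_pos_adj_mult_self)

lemma vec_ip_mat_vec:
  "vec_ip n x (mat_vec n S y) = (\<Sum>i<n. \<Sum>j<n. adj (x i) * S i j * y j)"
  by (simp add: vec_ip_def mat_vec_def sum_distrib_left mult.assoc)

lemma vec_ip_hermitian:
  assumes "\<And>i j. i < n \<Longrightarrow> j < n \<Longrightarrow> adj (S i j) = S j i"
  shows "vec_ip n (mat_vec n S x) y = vec_ip n x (mat_vec n S y)"
proof -
  have "vec_ip n (mat_vec n S x) y = (\<Sum>i<n. \<Sum>j<n. adj (x j) * S j i * y i)"
    by (simp add: vec_ip_def mat_vec_def adj_sum adj_mult sum_distrib_right assms)
  also have "\<dots> = (\<Sum>j<n. \<Sum>i<n. adj (x j) * S j i * y i)" by (rule sum.swap)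
  finally show ?thesis by (simp add: vec_ip_mat_vec)
qed

lemma op_bound_mul:
  assumes "op_bound n S r" "op_bound n R s"
  shows "op_bound n (mat_mul n S R) (r * s)"
  unfolding op_bound_def
proof
  fix x
  let ?y = "mat_vec n R x"
  have "A_le (vec_ip n (mat_vec n S ?y) (mat_vec n S ?y)) (r\<^sup>2 *\<^sub>R vec_ip n ?y ?y)"
    using assms by (simp add: op_bound_def)
  also have "A_le (r\<^sup>2 *\<^sub>R vec_ip n ?y ?y) (r\<^sup>2 *\<^sub>R (s\<^sup>2 *\<^sub>R vec_ip n x x))"
    using assms by (intro A_le_scaleR) (simp_all add: op_bound_def)
  finally
  show "A_le (vec_ip n (mat_vec n (mat_mul n S R) x) (mat_vec n (mat_mul n S R) x))
     ((r * s)\<^sup>2 *\<^sub>R vec_ip n x x)"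
    by (simp add: mat_vec_mul power_mult_distrib)
qed

lemma op_bound_scaleR:
  assumes "op_bound n S r"
  shows "op_bound n (\<lambda>i j. c *\<^sub>R S i j) (c * r)"
  unfolding op_bound_def
proof
  fix x
  have "A_le (c\<^sup>2 *\<^sub>R vec_ip n (mat_vec n S x) (mat_vec n S x)) (c\<^sup>2 *\<^sub>R (r\<^sup>2 *\<^sub>R vec_ip n x x))"
    using assms by (intro A_le_scaleR) (simp_all add: op_bound_def)
  then show "A_le (vec_ip n (mat_vec n (\<lambda>i j. c *\<^sub>R S i j) x) (mat_vec n (\<lambda>i j. c *\<^sub>R S i j) x))
     ((c * r)\<^sup>2 *\<^sub>R vec_ip n x x)"
    by (simp add: mat_vec_scaleR vec_ip_simps power2_eq_square mult_ac)
qed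

text \<open>The weights \<open>s / r\<close> and \<open>r / s\<close> turn the parallelogram bound into the triangle inequality.\<close>

lemma op_bound_add:
  assumes S: "op_bound n S r" and R: "op_bound n R s" and pos: "0 < r" "0 < s"
  shows "op_bound n (\<lambda>i j. S i j + R i j) (r + s)"
  unfolding op_bound_def
proof
  fix x
  let ?u = "mat_vec n S x" and ?v = "mat_vec n R x"
  let ?w = "\<lambda>i. sqrt (s / r) *\<^sub>R ?u i - sqrt (r / s) *\<^sub>R ?v i"
  have sq: "sqrt (s / r) * sqrt (s / r) = s / r" "sqrt (r / s) * sqrt (r / s) = r / s"
    "sqrt (s / r) * sqrt (r / s) = 1" "sqrt (r / s) * sqrt (s / r) = 1"
    using pos by (simp_all flip: real_sqrt_mult)
  have w: "vec_ip n ?w ?w = (s / r) *\<^sub>R vec_ip n ?u ?u + (r / s) *\<^sub>R vec_ip n ?v ?v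
      - (vec_ip n ?u ?v + vec_ip n ?v ?u)"
    using pos by (simp add: vec_ip_simps scaleR_diff_right sq algebra_simps)
  have "A_le (vec_ip n ?u ?v + vec_ip n ?v ?u)
      ((s / r) *\<^sub>R vec_ip n ?u ?u + (r / s) *\<^sub>R vec_ip n ?v ?v)"
    unfolding A_le_def w[symmetric] by (rule A_pos_vec_ip)
  then have "A_le (vec_ip n ?u ?u + vec_ip n ?v ?v + (vec_ip n ?u ?v + vec_ip n ?v ?u))
     (vec_ip n ?u ?u + vec_ip n ?v ?v + ((s / r) *\<^sub>R vec_ip n ?u ?u + (r / s) *\<^sub>R vec_ip n ?v ?v))"
    by (rule A_le_add[OF A_le_refl])
  then have "A_le (vec_ip n (\<lambda>i. ?u i + ?v i) (\<lambda>i. ?u i + ?v i))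
     ((1 + s / r) *\<^sub>R vec_ip n ?u ?u + (1 + r / s) *\<^sub>R vec_ip n ?v ?v)"
    by (simp add: vec_ip_simps algebra_simps)
  also have "A_le \<dots> ((1 + s / r) *\<^sub>R (r\<^sup>2 *\<^sub>R vec_ip n x x) + (1 + r / s) *\<^sub>R (s\<^sup>2 *\<^sub>R vec_ip n x x))"
    using S R pos by (intro A_le_add A_le_scaleR) (simp_all add: op_bound_def)
  also have "\<dots> = (r + s)\<^sup>2 *\<^sub>R vec_ip n x x"
  proof -
    have "(1 + s / r) * r\<^sup>2 + (1 + r / s) * s\<^sup>2 = (r + s)\<^sup>2"
      using pos by (simp add: field_simps power2_eq_square)
    then show ?thesis by (simp flip: scaleR_left_distrib)
  qed
  finally show "A_le (vec_ip n (mat_vec n (\<lambda>i j. S i j + R i j) x) (mat_vec n (\<lambda>i j. S i j + R i j) x))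
     ((r + s)\<^sup>2 *\<^sub>R vec_ip n x x)"
    by (simp add: mat_vec_add)
qed

text \<open>Testing on the unit vector \<open>?e\<close> bounds column \<open>j\<close>, in which
  the chosen entry contributes one of several positive summands. This passes from operator bounds to
  entrywise convergence.\<close>

lemma norm_entry_le_op_bound:
  assumes S: "op_bound n S r" and ij: "i < n" "j < n" and r: "0 \<le> r"
  shows "norm (S i j) \<le> r"
proof -
  let ?e = "\<lambda>k. if k = j then 1 else (0::'a)"
  have e: "vec_ip n ?e ?e = 1" "mat_vec n S ?e = (\<lambda>i. S i j)"
    using ij by (simp_all add: vec_ip_def mat_vec_def if_distrib[of "(*) _"] if_distrib[of adj]
        cong: if_cong)
  have "vec_ip n (\<lambda>i. S i j) (\<lambda>i. S i j)
      = adj (S i j) * S i j + (\<Sum>k\<in>{..<n} - {i}. adj (S k j) * S k j)"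
    unfolding vec_ip_def using ij by (intro sum.remove) auto
  then have "A_le (adj (S i j) * S i j) (vec_ip n (\<lambda>i. S i j) (\<lambda>i. S i j))"
    by (simp add: A_le_def A_pos_sum A_pos_adj_mult_self)
  also have "A_le \<dots> (r\<^sup>2 *\<^sub>R 1)"
    using S e unfolding op_bound_def by metis
  finally have "A_pos (of_real (r\<^sup>2) - adj (S i j) * S i j)" by (simp add: A_le_def of_real_def)
  from norm_le_if_A_pos_le[OF A_pos_adj_mult_self this]
  have "(norm (S i j))\<^sup>2 \<le> r\<^sup>2" by (simp add: cstar_identity power2_eq_square)
  then show ?thesis using r by (rule power2_le_imp_le)
qed

primrec mat_sqrt_iter :: "nat \<Rightarrow> (nat \<Rightarrow> nat \<Rightarrow> 'a::cstar_algebra) \<Rightarrow> nat \<Rightarrow> nat \<Rightarrow> nat \<Rightarrow> 'a" where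
  "mat_sqrt_iter n Z 0 = (\<lambda>i j. (1/2) *\<^sub>R Z i j)"
| "mat_sqrt_iter n Z (Suc m) =
     (\<lambda>i j. (1/2) *\<^sub>R (Z i j + mat_mul n (mat_sqrt_iter n Z m) (mat_sqrt_iter n Z m) i j))"

lemma op_bound_mat_sqrt_iter:
  assumes "op_bound n Z 1"
  shows "op_bound n (mat_sqrt_iter n Z m) (sqrt_maj m)"
proof (induction m)
  case 0
  then show ?case using op_bound_scaleR[OF assms, of "1/2"] by simp
next
  case (Suc m)
  have "op_bound n (\<lambda>i j. Z i j + mat_mul n (mat_sqrt_iter n Z m) (mat_sqrt_iter n Z m) i j)
      (1 + sqrt_maj m * sqrt_maj m)"
    using sqrt_maj_bounds by (intro op_bound_add op_bound_mul Suc assms) simp_all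
  from op_bound_scaleR[OF this, of "1/2"] show ?case by simp
qed

lemma op_bound_mat_sqrt_iter_diff:
  assumes "op_bound n Z 1"
  shows "op_bound n (\<lambda>i j. mat_sqrt_iter n Z (Suc m) i j - mat_sqrt_iter n Z m i j)
    (sqrt_maj (Suc m) - sqrt_maj m)"
proof (induction m)
  case 0
  have "(\<lambda>i j. mat_sqrt_iter n Z (Suc 0) i j - mat_sqrt_iter n Z 0 i j)
      = (\<lambda>i j. (1/8) *\<^sub>R mat_mul n Z Z i j)"
    by (simp add: mat_mul_def scaleR_add_right flip: scaleR_sum_right)
  then show ?case
    using op_bound_scaleR[OF op_bound_mul[OF assms assms], of "1/8"] by simp
next
  case (Suc m)
  let ?p = "mat_sqrt_iter n Z (Suc m)" and ?q = "mat_sqrt_iter n Z m"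
  let ?r = "sqrt_maj (Suc m)" and ?s = "sqrt_maj m"
  let ?d = "\<lambda>i j. ?p i j - ?q i j"
  \<comment> \<open>\<open>op_bound_add\<close> divides by both bounds, so the majorant has to
    increase strictly.\<close>
  have pos: "0 < ?r" "0 < ?s" "0 < ?r - ?s"
    using sqrt_maj_bounds sqrt_maj_less[of m] by (simp_all only: diff_gt_0_iff_gt)
  have "op_bound n (\<lambda>i j. mat_mul n ?p ?d i j + mat_mul n ?d ?q i j)
      (?r * (?r - ?s) + (?r - ?s) * ?s)"
    using pos by (intro op_bound_add op_bound_mul op_bound_mat_sqrt_iter assms Suc mult_pos_pos)
  from op_bound_scaleR[OF this, of "1/2"]
  have "op_bound n (\<lambda>i j. (1/2) *\<^sub>R (mat_mul n ?p ?d i j + mat_mul n ?d ?q i j))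
      (1/2 * (?r * (?r - ?s) + (?r - ?s) * ?s))" .
  also have "1/2 * (?r * (?r - ?s) + (?r - ?s) * ?s) = sqrt_maj (Suc (Suc m)) - ?r"
    by (simp add: field_simps)
  also have "(\<lambda>i j. (1/2) *\<^sub>R (mat_mul n ?p ?d i j + mat_mul n ?d ?q i j))
      = (\<lambda>i j. (1/2) *\<^sub>R (Z i j + mat_mul n ?p ?p i j) - (1/2) *\<^sub>R (Z i j + mat_mul n ?q ?q i j))"
  proof (intro ext)
    fix i j
    have "mat_mul n ?p ?d i j + mat_mul n ?d ?q i j = mat_mul n ?p ?p i j - mat_mul n ?q ?q i j"
      unfolding mat_mul_def left_diff_distrib right_diff_distrib sum_subtractf by simp
    then show "(1/2) *\<^sub>R (mat_mul n ?p ?d i j + mat_mul n ?d ?q i j)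
        = (1/2) *\<^sub>R (Z i j + mat_mul n ?p ?p i j) - (1/2) *\<^sub>R (Z i j + mat_mul n ?q ?q i j)"
      by (simp only:) (simp only: scaleR_add_right scaleR_diff_right, simp)
  qed
  also have "(\<lambda>i j. (1/2) *\<^sub>R (Z i j + mat_mul n ?p ?p i j) - (1/2) *\<^sub>R (Z i j + mat_mul n ?q ?q i j))
      = (\<lambda>i j. mat_sqrt_iter n Z (Suc (Suc m)) i j - ?p i j)"
    by (simp only: mat_sqrt_iter.simps(2))
  finally show ?case .
qed

lemma mat_sqrt_iter_hermitian:
  assumes "\<And>i j. i < n \<Longrightarrow> j < n \<Longrightarrow> adj (Z i j) = Z j i" "i < n" "j < n"
  shows "adj (mat_sqrt_iter n Z m i j) = mat_sqrt_iter n Z m j i"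
  using assms(2,3)
proof (induction m arbitrary: i j)
  case (Suc m)
  then show ?case
    by (simp add: adj_scaleR adj_add adj_sum adj_mult mat_mul_def assms(1))
qed (simp add: adj_scaleR assms(1))

text \<open>A weighted Cauchy-Schwarz inequality: expand the square of
  \<open>sqrt K x - t y / sqrt K\<close> and use that \<open>adj t * t\<close> is at most
  \<open>K^2\<close>.\<close>

lemma A_le_cross_term:
  fixes t x y :: "'a::cstar_algebra"
  assumes "norm t \<le> K" "0 < K"
  shows "A_le (adj x * t * y + adj y * adj t * x) (K *\<^sub>R (adj x * x + adj y * y))"
proof -
  define w where "w = sqrt K *\<^sub>R x - (1 / sqrt K) *\<^sub>R (t * y)"
  have sq: "sqrt K * sqrt K = K" "sqrt K \<noteq> 0" using assms(2) by simp_all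
  have w: "adj w * w = K *\<^sub>R (adj x * x) + (1 / K) *\<^sub>R (adj y * (adj t * t) * y)
      - (adj x * t * y + adj y * adj t * x)"
    using sq by (simp add: w_def adj_diff adj_scaleR adj_mult algebra_simps)
  have 1: "A_le (adj x * t * y + adj y * adj t * x)
      (K *\<^sub>R (adj x * x) + (1 / K) *\<^sub>R (adj y * (adj t * t) * y))"
    unfolding A_le_def w[symmetric] by (rule A_pos_adj_mult_self)
  have "norm (adj t * t) \<le> K * K"
    using assms by (simp add: cstar_identity mult_mono)
  then have "A_pos (of_real (K * K) - adj t * t)"
    by (intro A_pos_of_real_diff A_sa_simps)
  from A_pos_conj[OF this, of y] have "A_le (adj y * (adj t * t) * y) ((K * K) *\<^sub>R (adj y * y))"
    unfolding A_le_def by (simp only: right_diff_distrib left_diff_distrib) (simp add: of_real_def)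
  then have "A_le ((1 / K) *\<^sub>R (adj y * (adj t * t) * y)) ((1 / K) *\<^sub>R ((K * K) *\<^sub>R (adj y * y)))"
    using assms(2) by (intro A_le_scaleR) auto
  then have "A_le ((1 / K) *\<^sub>R (adj y * (adj t * t) * y)) (K *\<^sub>R (adj y * y))"
    using assms(2) by simp
  then have "A_le (K *\<^sub>R (adj x * x) + (1 / K) *\<^sub>R (adj y * (adj t * t) * y))
      (K *\<^sub>R (adj x * x) + K *\<^sub>R (adj y * y))"
    by (intro A_le_add) auto
  from A_le_trans[OF 1 this] show ?thesis by (simp add: scaleR_add_right)
qed

lemma A_le_sum: "(\<And>i. i \<in> I \<Longrightarrow> A_le (f i) (g i)) \<Longrightarrow> A_le (sum f I) (sum g I)"
  by (simp add: A_le_def A_pos_sum flip: sum_subtractf)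

text \<open>The root iteration for matrices can only start after rescaling; this provides the
  scale.\<close>

lemma hermitian_form_le:
  fixes T :: "nat \<Rightarrow> nat \<Rightarrow> 'a::cstar_algebra"
  assumes herm: "\<And>i j. i < n \<Longrightarrow> j < n \<Longrightarrow> adj (T i j) = T j i" and n: "0 < n"
  obtains c where "0 < c" "\<And>x. A_le (vec_ip n x (mat_vec n T x)) (c *\<^sub>R vec_ip n x x)"
proof
  \<comment> \<open>The summand \<open>1\<close> keeps \<open>K\<close> positive even if all entries
    vanish.\<close>
  define K where "K = 1 + (\<Sum>i<n. \<Sum>j<n. norm (T i j))"
  have K0: "0 < K" by (simp add: K_def add_pos_nonneg sum_nonneg)
  have K: "norm (T i j) \<le> K" if "i < n" "j < n" for i j
  proof -
    have "norm (T i j) \<le> (\<Sum>j<n. norm (T i j))" using that by (intro member_le_sum) auto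
    also have "\<dots> \<le> (\<Sum>i<n. \<Sum>j<n. norm (T i j))"
      using that by (intro member_le_sum[where f="\<lambda>i. \<Sum>j<n. norm (T i j)"]) (auto intro: sum_nonneg)
    finally show ?thesis by (simp add: K_def)
  qed
  show "0 < real n * K" using n K0 by simp
  fix x
  let ?q = "vec_ip n x (mat_vec n T x)"
  have "?q = (\<Sum>i<n. \<Sum>j<n. adj (x i) * T i j * x j)" by (rule vec_ip_mat_vec)
  \<comment> \<open>Adding the form to itself with the indices exchanged pairs each entry with its
    adjoint, the shape of \<open>A_le_cross_term\<close>.\<close>
  moreover have "?q = (\<Sum>i<n. \<Sum>j<n. adj (x j) * T j i * x i)"
    unfolding vec_ip_mat_vec by (rule sum.swap)
  ultimately have "?q + ?q = (\<Sum>i<n. \<Sum>j<n. adj (x i) * T i j * x j + adj (x j) * adj (T i j) * x i)"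
    by (simp add: sum.distrib herm)
  moreover have "A_le \<dots> (\<Sum>i<n. \<Sum>j<n. K *\<^sub>R (adj (x i) * x i + adj (x j) * x j))"
    by (intro A_le_sum A_le_cross_term K K0) auto
  moreover have "(\<Sum>i<n. \<Sum>j<n. K *\<^sub>R (adj (x i) * x i + adj (x j) * x j))
      = (2 * (real n * K)) *\<^sub>R vec_ip n x x"
  proof -
    have "(\<Sum>j<n. K *\<^sub>R (adj (x i) * x i + adj (x j) * x j))
        = (real n * K) *\<^sub>R (adj (x i) * x i) + K *\<^sub>R vec_ip n x x" for i
      by (simp add: vec_ip_def scaleR_add_right sum.distrib sum_constant_scaleR scaleR_sum_right
          del: sum_constant)
    then have "(\<Sum>i<n. \<Sum>j<n. K *\<^sub>R (adj (x i) * x i + adj (x j) * x j))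
        = (real n * K) *\<^sub>R vec_ip n x x + real n *\<^sub>R K *\<^sub>R vec_ip n x x"
      by (simp add: sum.distrib sum_constant_scaleR vec_ip_def scaleR_sum_right del: sum_constant)
    then show ?thesis by (simp flip: scaleR_left_distrib)
  qed
  ultimately have "A_le (?q + ?q) ((2 * (real n * K)) *\<^sub>R vec_ip n x x)" by simp
  from A_le_scaleR[OF this, of "1/2"] show "A_le ?q ((real n * K) *\<^sub>R vec_ip n x x)"
    by (simp flip: scaleR_2)
qed

text \<open>The form of \<open>B = T / c\<close> lies between \<open>0\<close> and that of the
  identity, so \<open>Z = 1 - B\<close> is a contraction and the iteration converges entrywise to a
  hermitian \<open>P\<close> with \<open>(1 - P)^2 = B\<close>. Then
  \<open>Y = sqrt c (1 - P)\<close> is a hermitian root of \<open>T\<close>.\<close>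

theorem matrix_square_if_form_positive:
  fixes T :: "nat \<Rightarrow> nat \<Rightarrow> 'a::cstar_algebra"
  assumes herm: "\<And>i j. i < n \<Longrightarrow> j < n \<Longrightarrow> adj (T i j) = T j i"
    and pos: "\<And>x. A_pos (vec_ip n x (mat_vec n T x))"
  shows "\<exists>Y. \<forall>i<n. \<forall>j<n. T i j = (\<Sum>k<n. adj (Y k i) * Y k j)"
proof (cases "n = 0")
  case False
  then have "0 < n" by simp
  obtain c where c: "0 < c" "\<And>x. A_le (vec_ip n x (mat_vec n T x)) (c *\<^sub>R vec_ip n x x)"
    by (rule hermitian_form_le[of n T, OF herm \<open>0 < n\<close>]) (assumption+, rule that)
  define B where "B = (\<lambda>i j. (1 / c) *\<^sub>R T i j)"
  define Z where "Z = (\<lambda>i j. (if i = j then 1 else 0) - B i j)"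
  have hB: "adj (B i j) = B j i" if "i < n" "j < n" for i j
    using that by (simp add: B_def adj_scaleR herm)
  have hZ: "adj (Z i j) = Z j i" if "i < n" "j < n" for i j
    using that by (simp add: Z_def adj_diff hB)
  have B0: "A_pos (vec_ip n x (mat_vec n B x))" for x
    using pos[of x] c(1) by (simp add: B_def mat_vec_scaleR vec_ip_simps A_pos_scaleR)
  have B1: "A_pos (vec_ip n x x - vec_ip n x (mat_vec n B x))" for x
  proof -
    have "A_le (vec_ip n x (mat_vec n B x)) ((1 / c) *\<^sub>R (c *\<^sub>R vec_ip n x x))"
      using c(1) A_le_scaleR[OF c(2), of "1 / c" x] by (simp add: B_def mat_vec_scaleR vec_ip_simps)
    then show ?thesis using c(1) by (simp add: A_le_def)
  qed
  have "op_bound n Z 1"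
    unfolding op_bound_def
  proof
    fix x
    define b where "b = mat_vec n B x"
    define v where "v = (\<lambda>i. x i - b i)"
    have Bv: "mat_vec n B v = (\<lambda>i. b i - mat_vec n B b i)"
      by (simp add: v_def mat_vec_diff_right b_def)
    have Zx: "mat_vec n Z x i = v i" if "i < n" for i
      using that by (simp add: mat_vec_def Z_def v_def b_def left_diff_distrib sum_subtractf
          if_distrib[of "\<lambda>a. a * _"] cong: if_cong)
    \<comment> \<open>The form of \<open>B (1 - B)\<close>, written as
      \<open>(1 - B) B (1 - B) + B (1 - B) B\<close>, where both terms are visibly positive.\<close>
    have "vec_ip n b v = vec_ip n v (mat_vec n B v) + (vec_ip n b b - vec_ip n b (mat_vec n B b))"
    proof -
      have "vec_ip n v (mat_vec n B v) = vec_ip n (mat_vec n B v) v"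
        using vec_ip_hermitian[OF hB] by simp
      also have "\<dots> = vec_ip n b v - vec_ip n (mat_vec n B b) v"
        by (simp add: Bv vec_ip_simps)
      also have "vec_ip n (mat_vec n B b) v = vec_ip n b (mat_vec n B v)"
        using vec_ip_hermitian[OF hB] by simp
      also have "\<dots> = vec_ip n b b - vec_ip n b (mat_vec n B b)"
        by (simp add: Bv vec_ip_simps)
      finally show ?thesis by simp
    qed
    moreover have "vec_ip n x x - vec_ip n v v = vec_ip n x b + vec_ip n b v"
      by (simp add: v_def vec_ip_simps)
    ultimately have "A_pos (vec_ip n x x - vec_ip n v v)"
      using B0[of x] B0[of v] B1[of b] by (simp add: A_pos_add b_def)
    moreover have "vec_ip n (mat_vec n Z x) (mat_vec n Z x) = vec_ip n v v"
      by (rule vec_ip_cong) (simp_all add: Zx)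
    ultimately show "A_le (vec_ip n (mat_vec n Z x) (mat_vec n Z x)) (1\<^sup>2 *\<^sub>R vec_ip n x x)"
      by (simp add: A_le_def)
  qed
  note bound = this
  have "\<exists>l. (\<lambda>m. mat_sqrt_iter n Z m i j) \<longlonglongrightarrow> l" if "i < n" "j < n" for i j
    using norm_entry_le_op_bound[OF op_bound_mat_sqrt_iter_diff[OF bound] that] sqrt_maj_less
    by (intro convergentD convergent_if_increments_le_sqrt_maj) (simp add: less_imp_le)
  then obtain P where P: "\<And>i j. i < n \<Longrightarrow> j < n \<Longrightarrow> (\<lambda>m. mat_sqrt_iter n Z m i j) \<longlonglongrightarrow> P i j"
    by metis
  have hP: "adj (P i j) = P j i" if "i < n" "j < n" for i j
  proof (rule LIMSEQ_unique)
    show "(\<lambda>m. mat_sqrt_iter n Z m j i) \<longlonglongrightarrow> adj (P i j)"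
      using tendsto_adj[OF P[OF that]] that by (simp add: mat_sqrt_iter_hermitian hZ)
    show "(\<lambda>m. mat_sqrt_iter n Z m j i) \<longlonglongrightarrow> P j i" using P that by simp
  qed
  have eqP: "P i j + P i j = Z i j + (\<Sum>k<n. P i k * P k j)" if ij: "i < n" "j < n" for i j
  proof -
    have "(\<lambda>m. mat_sqrt_iter n Z (Suc m) i j) \<longlonglongrightarrow> (1/2) *\<^sub>R (Z i j + (\<Sum>k<n. P i k * P k j))"
      unfolding mat_sqrt_iter.simps mat_mul_def using ij by (intro tendsto_intros P) auto
    with LIMSEQ_Suc[OF P[OF ij]] have "P i j = (1/2) *\<^sub>R (Z i j + (\<Sum>k<n. P i k * P k j))"
      by (rule LIMSEQ_unique)
    then have "2 *\<^sub>R P i j = 2 *\<^sub>R ((1/2) *\<^sub>R (Z i j + (\<Sum>k<n. P i k * P k j)))"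
      by (rule arg_cong)
    then show ?thesis by (simp add: scaleR_2)
  qed
  define Y where "Y = (\<lambda>i j. sqrt c *\<^sub>R ((if i = j then 1 else 0) - P i j))"
  have "T i j = (\<Sum>k<n. adj (Y k i) * Y k j)" if ij: "i < n" "j < n" for i j
  proof -
    have "(\<Sum>k<n. adj (Y k i) * Y k j)
      = (\<Sum>k<n. c *\<^sub>R (((if k = i then 1 else 0) - P i k) * ((if k = j then 1 else 0) - P k j)))"
      using c(1) ij by (intro sum.cong) (auto simp: Y_def adj_scaleR adj_diff hP)
    also have "\<dots> = c *\<^sub>R (\<Sum>k<n. (if k = i then (if k = j then 1 else 0) - P k j else 0)
        - (if k = j then P i k else 0) + P i k * P k j)"
      unfolding scaleR_sum_right by (intro sum.cong) (auto simp: algebra_simps)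
    also have "\<dots> = c *\<^sub>R ((if i = j then 1 else 0) - P i j - P i j + (\<Sum>k<n. P i k * P k j))"
      using ij by (simp add: sum.distrib sum_subtractf)
    also have "\<dots> = c *\<^sub>R ((if i = j then 1 else 0) - (P i j + P i j) + (\<Sum>k<n. P i k * P k j))"
      by (simp add: algebra_simps)
    also have "\<dots> = c *\<^sub>R B i j" unfolding eqP[OF ij] by (simp add: Z_def)
    also have "\<dots> = T i j" using c(1) by (simp add: B_def)
    finally show ?thesis by simp
  qed
  then show ?thesis by blast
qed simp

section \<open>The Stone space\<close>

context
  fixes U :: "'b::boolean_algebra set"
  assumes U: "U \<in> stone"
begin

lemma stone_top_mem: "top \<in> U" and stone_bot_notin: "bot \<notin> U"
  using U by (auto simp: stone_def ultrafilter_B_def)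

lemma stone_upward: "p \<in> U \<Longrightarrow> p \<le> q \<Longrightarrow> q \<in> U"
  using U by (auto simp: stone_def ultrafilter_B_def)

lemma stone_inf_iff: "inf p q \<in> U \<longleftrightarrow> p \<in> U \<and> q \<in> U"
proof
  assume "inf p q \<in> U"
  then show "p \<in> U \<and> q \<in> U" using stone_upward inf_le1 inf_le2 by metis
qed (use U in \<open>auto simp: stone_def ultrafilter_B_def\<close>)

lemma stone_compl_iff: "- p \<in> U \<longleftrightarrow> p \<notin> U"
proof -
  have "p \<in> U \<or> - p \<in> U" using U by (auto simp: stone_def ultrafilter_B_def)
  moreover have "\<not> (p \<in> U \<and> - p \<in> U)" using stone_inf_iff[of p "- p"] stone_bot_notin by simp
  ultimately show ?thesis by blast
qed

lemma stone_sup_iff: "sup p q \<in> U \<longleftrightarrow> p \<in> U \<or> q \<in> U"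
  using stone_compl_iff[of "sup p q"] by (auto simp: compl_sup stone_inf_iff stone_compl_iff)

end

lemmas stone_simps = stone_top_mem stone_bot_notin stone_inf_iff stone_compl_iff stone_sup_iff

text \<open>Compactness of the Stone space, as an induction principle: an ideal that meets every
  ultrafilter contains \<open>top\<close>.\<close>

lemma stone_compact_induct:
  fixes Q :: "'b::boolean_algebra \<Rightarrow> bool"
  assumes bot: "Q bot"
    and down: "\<And>p q. Q q \<Longrightarrow> p \<le> q \<Longrightarrow> Q p"
    and sup: "\<And>p q. Q p \<Longrightarrow> Q q \<Longrightarrow> Q (sup p q)"
    and cover: "\<And>U. U \<in> stone \<Longrightarrow> \<exists>p\<in>U. Q p"
  shows "Q top"
proof (rule ccontr)
  assume top: "\<not> Q top"
  \<comment> \<open>The filters disjoint from the ideal \<open>Q\<close>. A maximal one, given by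
    Zorn's lemma, turns out to be an ultrafilter, against \<open>cover\<close>.\<close>
  define F where "F = {X. top \<in> X \<and> (\<forall>p q. p \<in> X \<and> p \<le> q \<longrightarrow> q \<in> X) \<and>
      (\<forall>p q. p \<in> X \<and> q \<in> X \<longrightarrow> inf p q \<in> X) \<and> (\<forall>p\<in>X. \<not> Q p)}"
  have "{top} \<in> F" using top by (auto simp: F_def top_unique)
  then have "F \<noteq> {}" by blast
  moreover have "\<Union>C \<in> F" if C: "C \<noteq> {}" "subset.chain F C" for C
  proof -
    have sub: "C \<subseteq> F" using C by (auto simp: subset.chain_def)
    have "inf p q \<in> \<Union>C" if "p \<in> \<Union>C" "q \<in> \<Union>C" for p q
    proof -
      obtain X Y where XY: "X \<in> C" "Y \<in> C" "p \<in> X" "q \<in> Y" using \<open>p \<in> \<Union>C\<close> \<open>q \<in> \<Union>C\<close> by blast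
      then have "X \<subseteq> Y \<or> Y \<subseteq> X" using C by (auto simp: subset.chain_def)
      then obtain W where "W \<in> C" "p \<in> W" "q \<in> W" using XY by blast
      then have "inf p q \<in> W" using sub unfolding F_def by blast
      then show ?thesis using \<open>W \<in> C\<close> by blast
    qed
    moreover have "top \<in> \<Union>C" using C(1) sub unfolding F_def by blast
    moreover have "q \<in> \<Union>C" if "p \<in> \<Union>C" "p \<le> q" for p q using that sub unfolding F_def by blast
    moreover have "\<not> Q p" if "p \<in> \<Union>C" for p using that sub unfolding F_def by blast
    ultimately show ?thesis unfolding F_def by blast
  qed
  ultimately obtain M where M: "M \<in> F" and max: "\<And>X. X \<in> F \<Longrightarrow> M \<subseteq> X \<Longrightarrow> X = M"
    using subset_Zorn_nonempty[of F] by metis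
  have Mtop: "top \<in> M" and Mup: "\<And>p q. p \<in> M \<Longrightarrow> p \<le> q \<Longrightarrow> q \<in> M"
    and Minf: "\<And>p q. p \<in> M \<Longrightarrow> q \<in> M \<Longrightarrow> inf p q \<in> M" and MQ: "\<And>p. p \<in> M \<Longrightarrow> \<not> Q p"
    using M unfolding F_def by blast+
  have ext: "\<exists>a\<in>M. Q (inf a p)" if "p \<notin> M" for p
  proof (rule ccontr)
    assume no: "\<not> (\<exists>a\<in>M. Q (inf a p))"
    \<comment> \<open>The filter generated by \<open>M\<close> and \<open>p\<close>; if it avoided
      \<open>Q\<close>, maximality would put \<open>p\<close> into \<open>M\<close>.\<close>
    define X where "X = {q. \<exists>a\<in>M. inf a p \<le> q}"
    have "inf q r \<in> X" if qr: "q \<in> X" "r \<in> X" for q r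
    proof -
      obtain a b where ab: "a \<in> M" "inf a p \<le> q" "b \<in> M" "inf b p \<le> r"
        using qr unfolding X_def by blast
      have "inf (inf a b) p \<le> inf q r"
        using ab by (meson inf_greatest inf_le1 inf_le2 inf_mono order_refl order_trans)
      then show ?thesis using Minf[OF ab(1,3)] unfolding X_def by blast
    qed
    moreover have "top \<in> X" using Mtop unfolding X_def by auto
    moreover have "r \<in> X" if "q \<in> X" "q \<le> r" for q r
      using that order_trans unfolding X_def by blast
    moreover have "\<not> Q q" if "q \<in> X" for q using that no down unfolding X_def by blast
    ultimately have "X \<in> F" unfolding F_def by blast
    moreover have "M \<subseteq> X" unfolding X_def using inf_le1 by blast
    ultimately have "X = M" by (rule max)
    moreover have "p \<in> X" unfolding X_def using Mtop by force
    ultimately show False using that by blast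
  qed
  have "p \<in> M \<or> - p \<in> M" for p
  proof (rule ccontr)
    assume "\<not> (p \<in> M \<or> - p \<in> M)"
    then obtain a b where ab: "a \<in> M" "Q (inf a p)" "b \<in> M" "Q (inf b (- p))"
      using ext[of p] ext[of "- p"] by blast
    have "Q (inf (inf a b) p)" by (rule down[OF ab(2)]) (simp add: le_infI1)
    moreover have "Q (inf (inf a b) (- p))" by (rule down[OF ab(4)]) (simp add: le_infI1)
    ultimately have "Q (sup (inf (inf a b) p) (inf (inf a b) (- p)))" by (rule sup)
    then have "Q (inf a b)" by (simp flip: inf_sup_distrib1)
    then show False using MQ Minf ab by blast
  qed
  then have "M \<in> stone"
    unfolding stone_def ultrafilter_B_def
    by (intro CollectI conjI allI impI) (use Mtop MQ bot in \<open>auto intro: Mup Minf\<close>)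
  then show False using cover MQ by blast
qed

text \<open>If no ultrafilter contained \<open>p\<close>, each would contain \<open>- p\<close>, so
  the ideal of elements disjoint from \<open>p\<close> would meet all of them and contain
  \<open>top\<close>.\<close>

lemma stone_point_exists:
  fixes p :: "'b::boolean_algebra"
  assumes "p \<noteq> bot"
  obtains U where "U \<in> stone" "p \<in> U"
proof -
  have "\<exists>U\<in>stone. p \<in> U"
  proof (rule ccontr)
    assume no: "\<not> (\<exists>U\<in>stone. p \<in> U)"
    have "inf top p = bot"
    proof (rule stone_compact_induct[where Q="\<lambda>q. inf q p = bot"])
      show "inf q p = bot" if "inf r p = bot" "q \<le> r" for q r
        using inf_mono[OF that(2) order_refl, of p] that(1) by (simp add: bot_unique)
      show "\<exists>q\<in>U. inf q p = bot" if "U \<in> stone" for U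
        using no that by (intro bexI[of _ "- p"]) (auto simp: stone_compl_iff)
    qed (auto simp: inf_sup_distrib2)
    then show False using assms by simp
  qed
  then show thesis using that by blast
qed

lemma stone_leI:
  fixes p q :: "'b::boolean_algebra"
  assumes "\<And>U. U \<in> stone \<Longrightarrow> p \<in> U \<Longrightarrow> q \<in> U"
  shows "p \<le> q"
proof (rule ccontr)
  assume "\<not> p \<le> q"
  then have "inf p (- q) \<noteq> bot" by (metis inf_shunt double_compl)
  then obtain U where "U \<in> stone" "inf p (- q) \<in> U" by (rule stone_point_exists)
  then show False using assms by (auto simp: stone_simps)
qed

text \<open>Turns identities in \<open>B\<close> into propositional logic about membership in a
  single ultrafilter.\<close>

lemma stone_eqI:
  fixes p q :: "'b::boolean_algebra"
  assumes "\<And>U. U \<in> stone \<Longrightarrow> p \<in> U \<longleftrightarrow> q \<in> U"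
  shows "p = q"
  by (rule antisym) (use assms in \<open>auto intro: stone_leI\<close>)

lemma topspace_stone_top [simp]: "topspace stone_top = stone"
  by (auto simp: stone_top_def topology_generated_by_topspace stone_clopen_def dest: stone_top_mem)

lemma openin_stone_clopen: "openin stone_top (stone_clopen p)"
  unfolding stone_top_def by (rule topology_generated_by_Basis) simp

text \<open>Clopen sets of elements are closed under finite intersection, by \<open>inf\<close>, so
  the generating family is a base and not merely a subbase.\<close>

lemma stone_open_basis:
  assumes "openin stone_top W" "U \<in> W"
  obtains p where "p \<in> U" "stone_clopen p \<subseteq> W"
proof -
  have U: "U \<in> stone" using openin_subset[OF assms(1)] assms(2) by auto
  have "generate_topology_on (range stone_clopen) W"
    using assms(1) by (simp add: stone_top_def openin_topology_generated_by_iff)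
  then have "\<exists>p\<in>U. stone_clopen p \<subseteq> W" using assms(2)
  proof induction
    case (Int a b)
    then obtain p q where "p \<in> U" "stone_clopen p \<subseteq> a" "q \<in> U" "stone_clopen q \<subseteq> b" by blast
    then show ?case using U
      by (intro bexI[of _ "inf p q"]) (auto simp: stone_clopen_def stone_inf_iff)
  next
    case (UN K)
    then show ?case by (metis UnionE Union_upper subset_trans)
  next
    case (Basis s)
    then show ?case by (auto simp: stone_clopen_def)
  qed simp
  then show thesis using that by blast
qed

text \<open>With continuity expressed by limits, the closure properties of \<open>CS\<close> become
  instances of \<open>tendsto_intros\<close>.\<close>

lemma CS_iff:
  "f \<in> CS \<longleftrightarrow> (\<forall>U\<in>stone. (f \<longlongrightarrow> f U) (atin stone_top U)) \<and> (\<forall>U. U \<notin> stone \<longrightarrow> f U = 0)"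
  by (simp add: CS_def continuous_map_atin limitin_canonical_iff)

lemma CS_intros:
  shows CS_0: "(\<lambda>U. 0) \<in> CS"
    and CS_add: "f \<in> CS \<Longrightarrow> g \<in> CS \<Longrightarrow> (\<lambda>U. f U + g U) \<in> CS"
    and CS_diff: "f \<in> CS \<Longrightarrow> g \<in> CS \<Longrightarrow> (\<lambda>U. f U - g U) \<in> CS"
    and CS_mult: "f \<in> CS \<Longrightarrow> g \<in> CS \<Longrightarrow> (\<lambda>U. f U * g U) \<in> CS"
    and CS_scale: "f \<in> CS \<Longrightarrow> (\<lambda>U. c * f U) \<in> CS"
    and CS_cnj: "f \<in> CS \<Longrightarrow> (\<lambda>U. cnj (f U)) \<in> CS"
    and CS_Re: "f \<in> CS \<Longrightarrow> (\<lambda>U. complex_of_real (Re (f U))) \<in> CS"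
    and CS_Im: "f \<in> CS \<Longrightarrow> (\<lambda>U. complex_of_real (Im (f U))) \<in> CS"
  by (auto simp: CS_iff intro!: tendsto_intros)

lemma CS_sum: "(\<And>i. i \<in> I \<Longrightarrow> f i \<in> CS) \<Longrightarrow> (\<lambda>U. \<Sum>i\<in>I. f i U) \<in> CS"
  by (induction I rule: infinite_finite_induct) (simp_all add: CS_intros)

lemma chi_apply: "U \<in> stone \<Longrightarrow> chi p U = (if p \<in> U then 1 else 0)"
  by (simp add: chi_def stone_clopen_def)

lemma chi_outside: "U \<notin> stone \<Longrightarrow> chi p U = 0"
  by (simp add: chi_def stone_clopen_def)

lemma chi_CS: "chi p \<in> CS"
  unfolding CS_iff
proof (intro conjI ballI allI impI)
  fix U :: "'a set" assume U: "U \<in> stone"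
  define q where "q = (if p \<in> U then p else - p)"
  have q: "U \<in> stone_clopen q" using U by (auto simp: q_def stone_clopen_def stone_compl_iff)
  have "chi p V = chi p U" if "V \<in> stone_clopen q" for V
    using that U by (auto simp: q_def stone_clopen_def stone_compl_iff chi_apply split: if_splits)
  then have "eventually (\<lambda>V. chi p V = chi p U) (atin stone_top U)"
    unfolding eventually_atin using q openin_stone_clopen[of q] by blast
  then show "(chi p \<longlongrightarrow> chi p U) (atin stone_top U)" by (rule tendsto_eventually)
qed (rule chi_outside)

lemma CS_local:
  assumes f: "f \<in> CS" and U: "U \<in> stone" and e: "0 < e"
  obtains p where "p \<in> U" "\<And>V. V \<in> stone \<Longrightarrow> p \<in> V \<Longrightarrow> cmod (f V - f U) < e"
proof -
  have "(f \<longlongrightarrow> f U) (atin stone_top U)" using f U by (simp add: CS_iff)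
  then have "eventually (\<lambda>V. dist (f V) (f U) < e) (atin stone_top U)"
    using e by (rule tendstoD)
  then obtain W where W: "openin stone_top W" "U \<in> W" "\<forall>V\<in>W - {U}. dist (f V) (f U) < e"
    using U unfolding eventually_atin topspace_stone_top by blast
  obtain p where p: "p \<in> U" "stone_clopen p \<subseteq> W" using stone_open_basis[OF W(1,2)] .
  show thesis
  proof
    fix V assume "V \<in> stone" "p \<in> V"
    then have "V \<in> W" using p by (auto simp: stone_clopen_def)
    then show "cmod (f V - f U) < e" using W(3) e by (cases "V = U") (auto simp: dist_norm)
  qed (rule p)
qed

lemma CS_local_finite:
  assumes "finite F" "F \<subseteq> CS" and U: "U \<in> stone" and e: "0 < e"
  shows "\<exists>p\<in>U. \<forall>f\<in>F. \<forall>V\<in>stone. p \<in> V \<longrightarrow> cmod (f V - f U) < e"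
  using assms(1,2)
proof induction
  case empty
  then show ?case using stone_top_mem[OF U] by blast
next
  case (insert f F)
  then obtain p where "p \<in> U" "\<forall>f\<in>F. \<forall>V\<in>stone. p \<in> V \<longrightarrow> cmod (f V - f U) < e" by auto
  moreover obtain q where "q \<in> U" "\<And>V. V \<in> stone \<Longrightarrow> q \<in> V \<Longrightarrow> cmod (f V - f U) < e"
    using CS_local[of f U e] insert.prems U e by auto
  ultimately show ?case
    using U by (intro bexI[of _ "inf p q"]) (auto simp: stone_inf_iff)
qed

definition stone_partition :: "'b::boolean_algebra \<Rightarrow> 'b set \<Rightarrow> bool" where
  "stone_partition b P \<longleftrightarrow> finite P \<and> (\<forall>p\<in>P. \<forall>q\<in>P. p \<noteq> q \<longrightarrow> inf p q = bot) \<and>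
     (\<forall>U\<in>stone. b \<in> U \<longleftrightarrow> (\<exists>p\<in>P. p \<in> U))"

lemma stone_partitionI:
  assumes "finite P" "\<And>p q. p \<in> P \<Longrightarrow> q \<in> P \<Longrightarrow> p \<noteq> q \<Longrightarrow> inf p q = bot"
    "\<And>U. U \<in> stone \<Longrightarrow> b \<in> U \<longleftrightarrow> (\<exists>p\<in>P. p \<in> U)"
  shows "stone_partition b P"
  unfolding stone_partition_def by (intro conjI ballI impI assms)

lemma stone_partitionD:
  assumes "stone_partition b P"
  shows "finite P" "p \<in> P \<Longrightarrow> q \<in> P \<Longrightarrow> p \<noteq> q \<Longrightarrow> inf p q = bot"
    "U \<in> stone \<Longrightarrow> b \<in> U \<longleftrightarrow> (\<exists>p\<in>P. p \<in> U)"
  using assms unfolding stone_partition_def by simp_all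

text \<open>Compact induction over the elements \<open>b\<close> that have a partition into
  \<open>H\<close>-pieces; for a join of \<open>a\<close> and \<open>b\<close>, the pieces of
  \<open>b\<close> are first cut down by \<open>- a\<close>.\<close>

lemma stone_partition_exists:
  fixes H :: "'b::boolean_algebra \<Rightarrow> bool"
  assumes down: "\<And>p q. H q \<Longrightarrow> p \<le> q \<Longrightarrow> H p"
    and cover: "\<And>U. U \<in> stone \<Longrightarrow> \<exists>p\<in>U. H p"
  shows "\<exists>P. stone_partition top P \<and> (\<forall>p\<in>P. H p)"
proof -
  have H_inf: "H p \<Longrightarrow> H (inf a p)" for a p by (rule down) auto
  show ?thesis
  proof (rule stone_compact_induct[where Q="\<lambda>b. \<exists>P. stone_partition b P \<and> (\<forall>p\<in>P. H p)"])
    have "stone_partition (bot::'b) {}"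
      by (rule stone_partitionI) (simp_all add: stone_bot_notin)
    then show "\<exists>P. stone_partition (bot::'b) P \<and> (\<forall>p\<in>P. H p)" by blast
  next
    fix a b :: 'b
    assume "\<exists>P. stone_partition b P \<and> (\<forall>p\<in>P. H p)" and ab: "a \<le> b"
    then obtain P where P: "stone_partition b P" "\<forall>p\<in>P. H p" by blast
    have "stone_partition a (inf a ` P)"
    proof (rule stone_partitionI)
      show "finite (inf a ` P)" using stone_partitionD(1)[OF P(1)] by simp
      show "a \<in> U \<longleftrightarrow> (\<exists>p\<in>inf a ` P. p \<in> U)" if U: "U \<in> stone" for U
        using stone_upward[OF U _ ab] stone_partitionD(3)[OF P(1) U]
        by (auto simp: stone_inf_iff[OF U])
      fix x y assume "x \<in> inf a ` P" "y \<in> inf a ` P" "x \<noteq> y"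
      then obtain p q where "x = inf a p" "y = inf a q" "p \<in> P" "q \<in> P" "p \<noteq> q" by blast
      then show "inf x y = bot"
        using stone_partitionD(2)[OF P(1), of p q] by (simp add: inf_left_commute inf_assoc)
    qed
    moreover have "\<forall>p\<in>inf a ` P. H p" using P(2) H_inf by simp
    ultimately show "\<exists>P. stone_partition a P \<and> (\<forall>p\<in>P. H p)" by blast
  next
    fix a b :: 'b
    assume "\<exists>P. stone_partition a P \<and> (\<forall>p\<in>P. H p)" "\<exists>P. stone_partition b P \<and> (\<forall>p\<in>P. H p)"
    then obtain P R where PR: "stone_partition a P" "\<forall>p\<in>P. H p" "stone_partition b R" "\<forall>p\<in>R. H p"
      by blast
    let ?S = "P \<union> inf (- a) ` R"
    have PaR: "inf p (inf (- a) q) = bot" if "p \<in> P" "q \<in> R" for p q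
    proof (rule stone_eqI)
      fix U :: "'b set" assume U: "U \<in> stone"
      show "inf p (inf (- a) q) \<in> U \<longleftrightarrow> bot \<in> U"
        using that stone_partitionD(3)[OF PR(1) U] by (auto simp: stone_simps[OF U])
    qed
    have aRR: "inf x y = bot" if xy: "x \<in> inf (- a) ` R" "y \<in> inf (- a) ` R" "x \<noteq> y" for x y
    proof -
      obtain p q where "x = inf (- a) p" "y = inf (- a) q" "p \<in> R" "q \<in> R" "p \<noteq> q"
        using xy by blast
      then show ?thesis
        using stone_partitionD(2)[OF PR(3), of p q] by (simp add: inf_left_commute inf_assoc)
    qed
    have "stone_partition (sup a b) ?S"
    proof (rule stone_partitionI)
      show "finite ?S" using stone_partitionD(1)[OF PR(1)] stone_partitionD(1)[OF PR(3)] by simp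
      show "sup a b \<in> U \<longleftrightarrow> (\<exists>p\<in>?S. p \<in> U)" if U: "U \<in> stone" for U
        using stone_partitionD(3)[OF PR(1) U] stone_partitionD(3)[OF PR(3) U]
        by (auto simp: stone_simps[OF U] bex_Un)
      show "inf x y = bot" if xy: "x \<in> ?S" "y \<in> ?S" "x \<noteq> y" for x y
      proof (cases "x \<in> P")
        case x: True
        show ?thesis
        proof (cases "y \<in> P")
          case True
          show ?thesis by (rule stone_partitionD(2)[OF PR(1) x True xy(3)])
        next
          case False
          then obtain q where "q \<in> R" "y = inf (- a) q" using xy(2) by blast
          then show ?thesis using PaR[OF x] by simp
        qed
      next
        case x: False
        then obtain p where p: "p \<in> R" "x = inf (- a) p" using xy(1) by blast
        show ?thesis
        proof (cases "y \<in> P")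
          case True
          then show ?thesis using PaR[OF True p(1)] by (simp add: p(2) inf_commute)
        next
          case False
          then show ?thesis using aRR xy x by blast
        qed
      qed
    qed
    moreover have "\<forall>p\<in>?S. H p" using PR(2,4) H_inf by auto
    ultimately show "\<exists>P. stone_partition (sup a b) P \<and> (\<forall>p\<in>P. H p)" by blast
  next
    fix U :: "'b set" assume "U \<in> stone"
    then obtain p where "p \<in> U" "H p" using cover by blast
    moreover have "stone_partition p {p}" by (rule stone_partitionI) auto
    ultimately show "\<exists>p\<in>U. \<exists>P. stone_partition p P \<and> (\<forall>p\<in>P. H p)" by blast
  qed
qed

definition fine_partition :: "('b::boolean_algebra set \<Rightarrow> complex) \<Rightarrow> 'b set \<Rightarrow> real \<Rightarrow> bool" where
  "fine_partition f P e \<longleftrightarrow> 0 \<le> e \<and> stone_partition top P \<and>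
     (\<forall>p\<in>P. \<forall>U\<in>stone. \<forall>V\<in>stone. p \<in> U \<and> p \<in> V \<longrightarrow> cmod (f U - f V) \<le> e)"

lemma fine_partition_exists:
  fixes F :: "('b::boolean_algebra set \<Rightarrow> complex) set"
  assumes "finite F" "F \<subseteq> CS" "0 < e"
  shows "\<exists>P. \<forall>f\<in>F. fine_partition f P e"
proof -
  define H where "H p \<longleftrightarrow> (\<forall>f\<in>F. \<forall>U\<in>stone. \<forall>V\<in>stone. p \<in> U \<and> p \<in> V \<longrightarrow> cmod (f U - f V) \<le> e)"
    for p :: 'b
  have "\<exists>P. stone_partition top P \<and> (\<forall>p\<in>P. H p)"
  proof (rule stone_partition_exists)
    show "H p" if "H q" "p \<le> q" for p q
      using that stone_upward unfolding H_def by blast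
    fix U :: "'b set" assume "U \<in> stone"
    then obtain p where p: "p \<in> U" "\<forall>f\<in>F. \<forall>V\<in>stone. p \<in> V \<longrightarrow> cmod (f V - f U) < e/2"
      using CS_local_finite[OF assms(1,2), of U "e/2"] assms(3) by auto
    have "H p"
      unfolding H_def
    proof (intro ballI impI)
      fix f V W assume "f \<in> F" "V \<in> stone" "W \<in> stone" "p \<in> V \<and> p \<in> W"
      then have "cmod (f V - f U) < e/2" "cmod (f W - f U) < e/2" using p by auto
      then have "cmod ((f V - f U) - (f W - f U)) < e"
        using norm_triangle_ineq4[of "f V - f U" "f W - f U"] by simp
      then show "cmod (f V - f W) \<le> e" by simp
    qed
    then show "\<exists>p\<in>U. H p" using p by blast
  qed
  then obtain P where P: "stone_partition top P" "\<forall>p\<in>P. H p" by blast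
  have "\<forall>f\<in>F. fine_partition f P e"
    using P assms(3) unfolding fine_partition_def H_def by simp
  then show ?thesis by blast
qed

lemma stone_finite_union:
  fixes P :: "'b::boolean_algebra set"
  assumes "finite P"
  obtains s where "\<And>U. U \<in> stone \<Longrightarrow> s \<in> U \<longleftrightarrow> (\<exists>p\<in>P. p \<in> U)"
proof -
  have "\<exists>s. \<forall>U\<in>stone. s \<in> U \<longleftrightarrow> (\<exists>p\<in>P. p \<in> U)" using assms
  proof induction
    case empty
    then show ?case by (intro exI[of _ bot]) (simp add: stone_bot_notin)
  next
    case (insert p P)
    then obtain s where "\<forall>U\<in>stone. s \<in> U \<longleftrightarrow> (\<exists>p\<in>P. p \<in> U)" by blast
    then show ?case by (intro exI[of _ "sup p s"]) (auto simp: stone_sup_iff)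
  qed
  then show thesis using that by blast
qed

section \<open>Integration against a POVM\<close>

lemma A_is_sup_eventually_const:
  assumes sa: "A_sa x" and le: "\<And>n. A_le (s n) x" and eq: "s N = x"
  shows "A_is_sup s x"
  unfolding A_is_sup_def using assms by auto

lemma povm_A_pos: "povm \<mu> \<Longrightarrow> A_pos (\<mu> p)"
  by (simp add: povm_def)

lemma povm_top: "povm \<mu> \<Longrightarrow> \<mu> top = 1"
  by (simp add: povm_def)

lemma povm_sup_sequence:
  fixes q :: "nat \<Rightarrow> 'b::boolean_algebra"
  assumes "povm \<mu>" "\<And>n m. n \<noteq> m \<Longrightarrow> inf (q n) (q m) = bot" "B_is_lub s (range q)"
  shows "A_is_sup (\<lambda>n. \<Sum>k<n. \<mu> (q k)) (\<mu> s)"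
  using assms unfolding povm_def by blast

text \<open>In the constant sequence \<open>bot\<close>, the partial sum of length 2 lies below the
  supremum, so twice \<open>\<mu> bot\<close> is at most \<open>\<mu> bot\<close>.\<close>

lemma povm_bot:
  assumes "povm \<mu>"
  shows "\<mu> bot = 0"
proof -
  have "A_is_sup (\<lambda>n. \<Sum>k<n. \<mu> bot) (\<mu> bot)"
    using povm_sup_sequence[OF assms, of "\<lambda>_. bot" bot] by (simp add: B_is_lub_def)
  then have "A_le (\<Sum>k<2::nat. \<mu> bot) (\<mu> bot)" unfolding A_is_sup_def by blast
  then have "A_pos (\<mu> bot - (\<mu> bot + \<mu> bot))"
    by (simp only: A_le_def numeral_2_eq_2 sum.lessThan_Suc lessThan_0 sum.empty add_0_left)
  then have "A_pos (- \<mu> bot)" by simp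
  then show ?thesis using A_pos_antisym[OF povm_A_pos[OF assms]] by blast
qed

text \<open>The pair is padded with \<open>bot\<close>, of measure \<open>0\<close>, to a disjoint
  sequence whose partial sums are constant from length 2 on.\<close>

lemma povm_sup:
  fixes \<mu> :: "'b::boolean_algebra \<Rightarrow> 'a::cstar_algebra"
  assumes \<mu>: "povm \<mu>" and "inf p q = bot"
  shows "\<mu> (sup p q) = \<mu> p + \<mu> q"
proof -
  define r where "r k = (if k = 0 then p else if k = 1 then q else bot)" for k :: nat
  have "inf (r n) (r m) = bot" if "n \<noteq> m" for n m
    using that assms(2) by (auto simp: r_def inf_commute)
  moreover have "B_is_lub (sup p q) (range r)"
    unfolding B_is_lub_def
  proof (intro conjI allI impI ballI)
    show "x \<le> sup p q" if "x \<in> range r" for x using that by (auto simp: r_def)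
    fix t assume "\<forall>x\<in>range r. x \<le> t"
    then have "r 0 \<le> t" "r 1 \<le> t" by blast+
    then show "sup p q \<le> t" by (simp add: r_def)
  qed
  ultimately have sup: "A_is_sup (\<lambda>n. \<Sum>k<n. \<mu> (r k)) (\<mu> (sup p q))"
    by (rule povm_sup_sequence[OF \<mu>])
  have "(\<Sum>k<n. \<mu> (r k)) = (if n = 0 then 0 else if n = 1 then \<mu> p else \<mu> p + \<mu> q)" for n
  proof (induction n)
    case (Suc n)
    then show ?case by (cases n) (auto simp: r_def povm_bot[OF \<mu>])
  qed simp
  then have "A_is_sup (\<lambda>n. \<Sum>k<n. \<mu> (r k)) (\<mu> p + \<mu> q)"
    using povm_A_pos[OF \<mu>, of p] povm_A_pos[OF \<mu>, of q]
    by (intro A_is_sup_eventually_const[where N=2]) (auto simp: A_le_def A_pos_add A_sa_if_A_pos)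
  with sup show ?thesis by (rule A_is_sup_unique)
qed

text \<open>The factor \<open>r\<close> allows refinements to be summed over pairs of pieces; as a
  set of meets, a common refinement could merge different pairs.\<close>

lemma povm_partition_inf:
  assumes \<mu>: "povm \<mu>" and "stone_partition b P"
  shows "(\<Sum>p\<in>P. \<mu> (inf p r)) = \<mu> (inf b r)"
proof -
  have "finite P" by (rule stone_partitionD(1)[OF assms(2)])
  then show ?thesis using assms(2)
  proof (induction P arbitrary: b)
    case empty
    have "b = bot"
      by (rule stone_eqI) (simp add: stone_partitionD(3)[OF empty.prems] stone_bot_notin)
    then show ?case by (simp add: povm_bot[OF \<mu>])
  next
    case (insert p P)
    let ?c = "inf b (- p)"
    have disj: "inf p q = bot" if "q \<in> P" for q
      using insert.hyps that by (intro stone_partitionD(2)[OF insert.prems]) auto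
    have cov: "b \<in> U \<longleftrightarrow> p \<in> U \<or> (\<exists>q\<in>P. q \<in> U)" if "U \<in> stone" for U
      using stone_partitionD(3)[OF insert.prems that] by simp
    have pq: "\<not> (p \<in> U \<and> q \<in> U)" if "U \<in> stone" "q \<in> P" for U q
      using disj[OF that(2)] stone_inf_iff[OF that(1), of p q] stone_bot_notin[OF that(1)] by simp
    have "stone_partition ?c P"
    proof (rule stone_partitionI)
      show "finite P" by (rule insert.hyps)
      show "inf q q' = bot" if "q \<in> P" "q' \<in> P" "q \<noteq> q'" for q q'
        using that by (intro stone_partitionD(2)[OF insert.prems]) auto
      fix U :: "'a set" assume U: "U \<in> stone"
      show "inf b (- p) \<in> U \<longleftrightarrow> (\<exists>q\<in>P. q \<in> U)"
        unfolding stone_simps[OF U] cov[OF U] using pq[OF U] by blast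
    qed
    then have IH: "(\<Sum>p\<in>P. \<mu> (inf p r)) = \<mu> (inf ?c r)" by (rule insert.IH)
    have "inf b r = sup (inf p r) (inf ?c r)"
    proof (rule stone_eqI)
      fix U :: "'a set" assume U: "U \<in> stone"
      show "inf b r \<in> U \<longleftrightarrow> sup (inf p r) (inf ?c r) \<in> U"
        unfolding stone_simps[OF U] cov[OF U] by blast
    qed
    moreover have "inf (inf p r) (inf ?c r) = bot"
      by (rule stone_eqI) (auto simp: stone_simps)
    ultimately have "\<mu> (inf b r) = \<mu> (inf p r) + \<mu> (inf ?c r)" by (simp add: povm_sup[OF \<mu>])
    then show ?case using insert.hyps by (simp add: IH)
  qed
qed

lemma povm_partition: "povm \<mu> \<Longrightarrow> stone_partition b P \<Longrightarrow> sum \<mu> P = \<mu> b"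
  using povm_partition_inf[of \<mu> b P top] by simp

text \<open>At \<open>bot\<close> no such ultrafilter exists and the choice is arbitrary; this does
  no harm because \<open>\<mu> bot = 0\<close>.\<close>

definition stone_point :: "'b::boolean_algebra \<Rightarrow> 'b set" where
  "stone_point p = (SOME U. U \<in> stone \<and> p \<in> U)"

lemma stone_point:
  assumes "p \<noteq> bot"
  shows "stone_point p \<in> stone" "p \<in> stone_point p"
proof -
  obtain U where "U \<in> stone" "p \<in> U" using assms by (rule stone_point_exists)
  then have "U \<in> stone \<and> p \<in> U" by simp
  then have "stone_point p \<in> stone \<and> p \<in> stone_point p"
    unfolding stone_point_def by (rule someI)
  then show "stone_point p \<in> stone" "p \<in> stone_point p" by auto
qed

definition riemann_sum ::
  "('b::boolean_algebra \<Rightarrow> 'a::cstar_algebra) \<Rightarrow> ('b set \<Rightarrow> complex) \<Rightarrow> 'b set \<Rightarrow> 'a" where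
  "riemann_sum \<mu> f P = (\<Sum>p\<in>P. scaleC (f (stone_point p)) (\<mu> p))"

lemma riemann_sum_refine:
  assumes \<mu>: "povm \<mu>" and "stone_partition top Q"
  shows "riemann_sum \<mu> f P = (\<Sum>p\<in>P. \<Sum>q\<in>Q. scaleC (f (stone_point p)) (\<mu> (inf p q)))"
proof -
  have "(\<Sum>q\<in>Q. \<mu> (inf p q)) = \<mu> p" for p
    using povm_partition_inf[OF assms, of p] by (simp add: inf_commute)
  then show ?thesis by (simp add: riemann_sum_def flip: scaleC_sum_right)
qed

lemma fine_partition_cmod_le:
  assumes "fine_partition f P e" "p \<in> P" "U \<in> stone" "V \<in> stone" "p \<in> U" "p \<in> V"
  shows "cmod (f U - f V) \<le> e"
  using assms by (simp add: fine_partition_def)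

lemma fine_partition_exists_single:
  assumes "f \<in> CS" "0 < e"
  shows "\<exists>P. fine_partition f P e"
proof -
  have "\<exists>P. \<forall>g\<in>{f}. fine_partition g P e"
    using assms by (intro fine_partition_exists) simp_all
  then show ?thesis by simp
qed

text \<open>On pairs of pieces, a nonzero weight forces a point \<open>U\<close> common to
  \<open>p\<close> and \<open>q\<close>, and the two sample values differ from \<open>f U\<close> by
  at most \<open>d\<close> and \<open>e\<close>.\<close>

lemma norm_riemann_sum_diff:
  assumes \<mu>: "povm \<mu>" and P: "fine_partition f P d" and Q: "fine_partition f Q e"
  shows "norm (riemann_sum \<mu> f P - riemann_sum \<mu> f Q) \<le> 2 * (d + e)"
proof -
  have part: "stone_partition top P" "stone_partition top Q" and nn: "0 \<le> d" "0 \<le> e"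
    using P Q by (auto simp: fine_partition_def)
  let ?a = "\<lambda>(p, q). f (stone_point p) - f (stone_point q)" and ?m = "\<lambda>(p, q). \<mu> (inf p q)"
  have "riemann_sum \<mu> f Q = (\<Sum>p\<in>P. \<Sum>q\<in>Q. scaleC (f (stone_point q)) (\<mu> (inf p q)))"
    unfolding riemann_sum_refine[OF \<mu> part(1), of f Q] by (subst sum.swap) (simp add: inf_commute)
  then have "riemann_sum \<mu> f P - riemann_sum \<mu> f Q = (\<Sum>i\<in>P \<times> Q. scaleC (?a i) (?m i))"
    unfolding riemann_sum_refine[OF \<mu> part(2), of f P]
    by (simp add: scaleC_diff_left sum.cartesian_product split_def flip: sum_subtractf)
  also have "norm \<dots> \<le> 2 * (d + e)"
  proof (rule norm_sum_scaleC_le)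
    show "A_pos (?m i)" if "i \<in> P \<times> Q" for i using povm_A_pos[OF \<mu>] by (simp add: split_def)
    have "sum ?m (P \<times> Q) = (\<Sum>p\<in>P. \<Sum>q\<in>Q. \<mu> (inf q p))"
      by (simp add: sum.cartesian_product inf_commute)
    also have "\<dots> = 1"
      by (simp add: povm_partition_inf[OF \<mu> part(2)] povm_partition[OF \<mu> part(1)] povm_top[OF \<mu>])
    finally show "sum ?m (P \<times> Q) = 1" .
    show "cmod (?a i) \<le> d + e" if i: "i \<in> P \<times> Q" "?m i \<noteq> 0" for i
    proof -
      obtain p q where pq: "i = (p, q)" "p \<in> P" "q \<in> Q" using i(1) by blast
      have "inf p q \<noteq> bot" using i(2) pq(1) povm_bot[OF \<mu>] by auto
      then obtain U where U: "U \<in> stone" "inf p q \<in> U" by (rule stone_point_exists)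
      then have pU: "p \<in> U" "q \<in> U" by (simp_all add: stone_inf_iff)
      have "p \<noteq> bot" "q \<noteq> bot" using pU U(1) stone_bot_notin by auto
      then have "cmod (f (stone_point p) - f U) \<le> d" "cmod (f U - f (stone_point q)) \<le> e"
        using fine_partition_cmod_le[OF P pq(2) stone_point(1) U(1) stone_point(2) pU(1)]
          fine_partition_cmod_le[OF Q pq(3) U(1) stone_point(1) pU(2) stone_point(2)] by simp_all
      then have "cmod ((f (stone_point p) - f U) + (f U - f (stone_point q))) \<le> d + e"
        by (intro norm_triangle_le) simp
      then show ?thesis by (simp add: pq)
    qed
  qed (use nn in simp)
  finally show ?thesis .
qed

text \<open>Characterised by its error bound on every fine partition, instead of as a limit along a
  chosen sequence of partitions.\<close>

definition povm_integral ::
  "('b::boolean_algebra \<Rightarrow> 'a::cstar_algebra) \<Rightarrow> ('b set \<Rightarrow> complex) \<Rightarrow> 'a" where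
  "povm_integral \<mu> f =
     (THE a. \<forall>P e. fine_partition f P e \<longrightarrow> norm (riemann_sum \<mu> f P - a) \<le> 2 * e)"

lemma riemann_limit_unique:
  assumes f: "f \<in> CS"
    and a: "\<And>P e. fine_partition f P e \<Longrightarrow> norm (riemann_sum \<mu> f P - a) \<le> 2 * e"
    and b: "\<And>P e. fine_partition f P e \<Longrightarrow> norm (riemann_sum \<mu> f P - b) \<le> 2 * e"
  shows "a = b"
proof -
  have "norm (a - b) \<le> 0 + e" if e: "0 < e" for e
  proof -
    obtain P where P: "fine_partition f P (e / 4)"
      using fine_partition_exists_single[OF f, of "e / 4"] e by auto
    have "norm ((riemann_sum \<mu> f P - b) - (riemann_sum \<mu> f P - a)) \<le> 2 * (e / 4) + 2 * (e / 4)"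
      using a[OF P] b[OF P] by (intro norm_triangle_le_diff) simp
    then show ?thesis by simp
  qed
  then have "norm (a - b) \<le> 0" by (rule field_le_epsilon)
  then show ?thesis by simp
qed

text \<open>Sums along partitions of fineness \<open>1 / (n + 1)\<close> are Cauchy; letting
  \<open>n\<close> grow in the comparison with a fixed \<open>P\<close> leaves only the fineness of
  \<open>P\<close>.\<close>

lemma riemann_limit_exists:
  assumes \<mu>: "povm \<mu>" and f: "f \<in> CS"
  obtains a where "\<And>P e. fine_partition f P e \<Longrightarrow> norm (riemann_sum \<mu> f P - a) \<le> 2 * e"
proof -
  have "\<exists>P. fine_partition f P (inverse (real (Suc n)))" for n
    by (rule fine_partition_exists_single[OF f]) simp
  then obtain Q where Q: "\<And>n. fine_partition f (Q n) (inverse (real (Suc n)))" by metis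
  let ?X = "\<lambda>n. riemann_sum \<mu> f (Q n)"
  have "Cauchy ?X"
  proof (rule metric_CauchyI)
    fix e :: real assume "0 < e"
    then obtain N where N: "inverse (real (Suc N)) < e / 4"
      using reals_Archimedean[of "e / 4"] by auto
    have small: "inverse (real (Suc m)) < e / 4" if "m \<ge> N" for m
      using that N by (intro le_less_trans[OF le_imp_inverse_le N]) simp_all
    have "dist (?X m) (?X n) < e" if "m \<ge> N" "n \<ge> N" for m n
    proof -
      have "2 * (inverse (real (Suc m)) + inverse (real (Suc n))) < 2 * (e / 4 + e / 4)"
        by (intro mult_strict_left_mono add_strict_mono small that) simp
      from le_less_trans[OF norm_riemann_sum_diff[OF \<mu> Q[of m] Q[of n]] this]
      show ?thesis by (simp add: dist_norm)
    qed
    then show "\<exists>M. \<forall>m\<ge>M. \<forall>n\<ge>M. dist (?X m) (?X n) < e" by blast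
  qed
  then obtain a where a: "?X \<longlonglongrightarrow> a" using Cauchy_convergent convergentD by metis
  show thesis
  proof
    fix P e assume P: "fine_partition f P e"
    have "(\<lambda>n. norm (riemann_sum \<mu> f P - ?X n)) \<longlonglongrightarrow> norm (riemann_sum \<mu> f P - a)"
      by (intro tendsto_intros a)
    moreover have "(\<lambda>n. 2 * (e + inverse (real (Suc n)))) \<longlonglongrightarrow> 2 * (e + 0)"
      by (intro tendsto_intros LIMSEQ_inverse_real_of_nat)
    ultimately have "norm (riemann_sum \<mu> f P - a) \<le> 2 * (e + 0)"
      by (rule LIMSEQ_le) (intro exI allI impI norm_riemann_sum_diff[OF \<mu> P Q])
    then show "norm (riemann_sum \<mu> f P - a) \<le> 2 * e" by simp
  qed
qed

lemma povm_integral_approx: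
  assumes \<mu>: "povm \<mu>" and f: "f \<in> CS" and P: "fine_partition f P e"
  shows "norm (riemann_sum \<mu> f P - povm_integral \<mu> f) \<le> 2 * e"
proof -
  obtain a where a: "\<And>P e. fine_partition f P e \<Longrightarrow> norm (riemann_sum \<mu> f P - a) \<le> 2 * e"
    by (rule riemann_limit_exists[OF \<mu> f]) (rule that)
  have "povm_integral \<mu> f = a"
    unfolding povm_integral_def
  proof (rule the_equality)
    show "b = a" if b: "\<forall>P e. fine_partition f P e \<longrightarrow> norm (riemann_sum \<mu> f P - b) \<le> 2 * e" for b
      by (rule riemann_limit_unique[OF f]) (use a b in auto)
  qed (use a in blast)
  then show ?thesis using a[OF P] by simp
qed

lemma povm_integral_eqI:
  assumes "povm \<mu>" "f \<in> CS"
    "\<And>P e. fine_partition f P e \<Longrightarrow> norm (riemann_sum \<mu> f P - a) \<le> 2 * e"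
  shows "povm_integral \<mu> f = a"
  by (rule riemann_limit_unique[OF assms(2) povm_integral_approx[OF assms(1,2)] assms(3)])

text \<open>A single sequence of partitions for all of \<open>F\<close> lets algebraic relations
  between Riemann sums pass to the integrals.\<close>

lemma povm_integral_simultaneous:
  fixes \<mu> :: "'b::boolean_algebra \<Rightarrow> 'a::cstar_algebra"
  assumes \<mu>: "povm \<mu>" and F: "finite F" "F \<subseteq> CS"
  shows "\<exists>Q. \<forall>f\<in>F. (\<lambda>n. riemann_sum \<mu> f (Q n)) \<longlonglongrightarrow> povm_integral \<mu> f"
proof -
  have "\<exists>P. \<forall>f\<in>F. fine_partition f P (inverse (real (Suc n)))" for n
    by (rule fine_partition_exists[OF F]) simp
  then obtain Q where Q: "\<And>n f. f \<in> F \<Longrightarrow> fine_partition f (Q n) (inverse (real (Suc n)))"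
    by metis
  have "(\<lambda>n. riemann_sum \<mu> f (Q n)) \<longlonglongrightarrow> povm_integral \<mu> f" if f: "f \<in> F" for f
  proof -
    have bound: "norm (riemann_sum \<mu> f (Q n) - povm_integral \<mu> f) \<le> 2 * inverse (real (Suc n))" for n
      using f F(2) by (intro povm_integral_approx[OF \<mu> _ Q[OF f]]) auto
    have "(\<lambda>n. 2 * inverse (real (Suc n))) \<longlonglongrightarrow> 0"
      by (rule tendsto_mult_right_zero[OF LIMSEQ_inverse_real_of_nat])
    with always_eventually[OF allI[OF bound]]
    have "(\<lambda>n. riemann_sum \<mu> f (Q n) - povm_integral \<mu> f) \<longlonglongrightarrow> 0"
      by (rule Lim_null_comparison)
    then show "(\<lambda>n. riemann_sum \<mu> f (Q n)) \<longlonglongrightarrow> povm_integral \<mu> f"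
      by (simp add: LIM_zero_iff)
  qed
  then show ?thesis by blast
qed

context
  fixes \<mu> :: "'b::boolean_algebra \<Rightarrow> 'a::cstar_algebra"
  assumes \<mu>: "povm \<mu>"
begin

lemma povm_integral_add:
  assumes f: "f \<in> CS" and g: "g \<in> CS"
  shows "povm_integral \<mu> (\<lambda>U. f U + g U) = povm_integral \<mu> f + povm_integral \<mu> g"
proof -
  let ?F = "{f, g, \<lambda>U. f U + g U}"
  have "finite ?F" "?F \<subseteq> CS" using assms by (simp_all add: CS_add)
  from povm_integral_simultaneous[OF \<mu> this] obtain Q
    where Q: "\<forall>h\<in>?F. (\<lambda>n. riemann_sum \<mu> h (Q n)) \<longlonglongrightarrow> povm_integral \<mu> h" ..
  have "(\<lambda>n. riemann_sum \<mu> f (Q n) + riemann_sum \<mu> g (Q n))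
      \<longlonglongrightarrow> povm_integral \<mu> f + povm_integral \<mu> g"
    by (intro tendsto_add Q[rule_format]) simp_all
  moreover have "riemann_sum \<mu> (\<lambda>U. f U + g U) P = riemann_sum \<mu> f P + riemann_sum \<mu> g P" for P
    by (simp add: riemann_sum_def scaleC_add_left sum.distrib)
  moreover have "(\<lambda>n. riemann_sum \<mu> (\<lambda>U. f U + g U) (Q n)) \<longlonglongrightarrow> povm_integral \<mu> (\<lambda>U. f U + g U)"
    by (rule Q[rule_format]) simp
  ultimately show ?thesis by (simp only: LIMSEQ_unique)
qed

lemma povm_integral_scale:
  assumes f: "f \<in> CS"
  shows "povm_integral \<mu> (\<lambda>U. c * f U) = scaleC c (povm_integral \<mu> f)"
proof -
  let ?F = "{f, \<lambda>U. c * f U}"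
  have "finite ?F" "?F \<subseteq> CS" using assms by (simp_all add: CS_scale)
  from povm_integral_simultaneous[OF \<mu> this] obtain Q
    where Q: "\<forall>h\<in>?F. (\<lambda>n. riemann_sum \<mu> h (Q n)) \<longlonglongrightarrow> povm_integral \<mu> h" ..
  have "(\<lambda>n. scaleC c (riemann_sum \<mu> f (Q n))) \<longlonglongrightarrow> scaleC c (povm_integral \<mu> f)"
    by (intro bounded_linear.tendsto[OF bounded_linear_scaleC] Q[rule_format]) simp
  moreover have "riemann_sum \<mu> (\<lambda>U. c * f U) P = scaleC c (riemann_sum \<mu> f P)" for P
    by (simp add: riemann_sum_def scaleC_sum_right scaleC_scaleC)
  moreover have "(\<lambda>n. riemann_sum \<mu> (\<lambda>U. c * f U) (Q n)) \<longlonglongrightarrow> povm_integral \<mu> (\<lambda>U. c * f U)"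
    by (rule Q[rule_format]) simp
  ultimately show ?thesis by (simp only: LIMSEQ_unique)
qed

lemma C_linear_povm_integral: "C_linear (povm_integral \<mu>)"
  by (simp add: C_linear_def povm_integral_add povm_integral_scale)

lemma adj_povm_integral:
  assumes f: "f \<in> CS"
  shows "adj (povm_integral \<mu> f) = povm_integral \<mu> (\<lambda>U. cnj (f U))"
proof -
  let ?F = "{f, \<lambda>U. cnj (f U)}"
  have "finite ?F" "?F \<subseteq> CS" using assms by (simp_all add: CS_cnj)
  from povm_integral_simultaneous[OF \<mu> this] obtain Q
    where Q: "\<forall>h\<in>?F. (\<lambda>n. riemann_sum \<mu> h (Q n)) \<longlonglongrightarrow> povm_integral \<mu> h" ..
  have "(\<lambda>n. adj (riemann_sum \<mu> f (Q n))) \<longlonglongrightarrow> adj (povm_integral \<mu> f)"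
    by (intro tendsto_adj Q[rule_format]) simp
  moreover have "adj (riemann_sum \<mu> f P) = riemann_sum \<mu> (\<lambda>U. cnj (f U)) P" for P
    using A_sa_if_A_pos[OF povm_A_pos[OF \<mu>]]
    by (simp add: riemann_sum_def adj_sum adj_scaleC A_sa_def)
  moreover have "(\<lambda>n. riemann_sum \<mu> (\<lambda>U. cnj (f U)) (Q n)) \<longlonglongrightarrow> povm_integral \<mu> (\<lambda>U. cnj (f U))"
    by (rule Q[rule_format]) simp
  ultimately show ?thesis by (simp only: LIMSEQ_unique)
qed

lemma C_positive_povm_integral: "C_positive (povm_integral \<mu>)"
  unfolding C_positive_def
proof (intro ballI impI)
  fix f :: "'b set \<Rightarrow> complex"
  assume f: "f \<in> CS" and pos: "\<forall>U\<in>stone. Im (f U) = 0 \<and> 0 \<le> Re (f U)"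
  have "finite {f}" "{f} \<subseteq> CS" using f by simp_all
  from povm_integral_simultaneous[OF \<mu> this] obtain Q
    where "\<forall>h\<in>{f}. (\<lambda>n. riemann_sum \<mu> h (Q n)) \<longlonglongrightarrow> povm_integral \<mu> h" ..
  then have lim: "(\<lambda>n. riemann_sum \<mu> f (Q n)) \<longlonglongrightarrow> povm_integral \<mu> f" by simp
  have term_pos: "A_pos (scaleC (f (stone_point p)) (\<mu> p))" for p
  proof (cases "p = bot")
    case False
    then have "Im (f (stone_point p)) = 0" "0 \<le> Re (f (stone_point p))"
      using stone_point(1) pos by auto
    then have "A_pos (Re (f (stone_point p)) *\<^sub>R \<mu> p)"
      "scaleC (f (stone_point p)) (\<mu> p) = Re (f (stone_point p)) *\<^sub>R \<mu> p"
      using povm_A_pos[OF \<mu>, of p] scaleC_eq_scaleR[of "f (stone_point p)" "\<mu> p"]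
      by (simp_all add: A_pos_scaleR)
    then show ?thesis by simp
  qed (simp add: povm_bot[OF \<mu>])
  have "A_pos (riemann_sum \<mu> f P)" for P
    unfolding riemann_sum_def by (rule A_pos_sum) (rule term_pos)
  with lim show "A_pos (povm_integral \<mu> f)" by (rule A_pos_limit)
qed

lemma povm_integral_chi: "povm_integral \<mu> (chi p) = \<mu> p"
proof -
  \<comment> \<open>Were \<open>p = - p\<close>, the set \<open>{p, - p}\<close> would collapse to
    one piece; that happens only in the trivial algebra, excluded by \<open>0 \<noteq> 1\<close> in
    \<open>A\<close>.\<close>
  have "bot \<noteq> (top::'b)" using povm_bot[OF \<mu>] povm_top[OF \<mu>] by auto
  then have np: "p \<noteq> - p"
    by (metis boolean_algebra.conj_cancel_right boolean_algebra.disj_cancel_right inf.idem sup.idem)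
  have part: "stone_partition top {p, - p}"
    by (rule stone_partitionI) (auto simp: stone_simps inf_commute)
  have "fine_partition (chi p) {p, - p} 0"
    unfolding fine_partition_def using part by (auto simp: chi_apply stone_simps)
  from povm_integral_approx[OF \<mu> chi_CS this]
  have "povm_integral \<mu> (chi p) = riemann_sum \<mu> (chi p) {p, - p}" by simp
  also have "\<dots> = scaleC (chi p (stone_point p)) (\<mu> p) + scaleC (chi p (stone_point (- p))) (\<mu> (- p))"
    using np by (simp add: riemann_sum_def)
  also have "scaleC (chi p (stone_point p)) (\<mu> p) = \<mu> p"
    using stone_point[of p] by (cases "p = bot") (simp_all add: povm_bot[OF \<mu>] chi_apply scaleC_one)
  also have "scaleC (chi p (stone_point (- p))) (\<mu> (- p)) = 0"
  proof (cases "- p = bot")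
    case False
    from stone_point[OF this] show ?thesis by (simp add: chi_apply stone_compl_iff)
  qed (simp add: povm_bot[OF \<mu>])
  finally show ?thesis by simp
qed

text \<open>At each sample point \<open>G\<close> is a scalar matrix. Applying it to the vector
  \<open>x\<close> gives \<open>w\<close>, and the contribution of the piece \<open>p\<close> to the
  form is the sum of the conjugates \<open>adj (w k) * \<mu> p * w k\<close>.\<close>

lemma C_completely_positive_povm_integral: "C_completely_positive (povm_integral \<mu>)"
  unfolding C_completely_positive_def
proof (intro allI impI)
  fix n :: nat and G :: "nat \<Rightarrow> nat \<Rightarrow> 'b set \<Rightarrow> complex"
  assume G: "\<forall>i<n. \<forall>j<n. G i j \<in> CS"
  define H where "H i j = (\<lambda>U. \<Sum>k<n. cnj (G k i U) * G k j U)" for i j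
  have H: "H i j \<in> CS" if "i < n" "j < n" for i j
    unfolding H_def using G that by (intro CS_sum CS_mult CS_cnj) simp_all
  define T where "T i j = povm_integral \<mu> (H i j)" for i j
  have "\<exists>Y. \<forall>i<n. \<forall>j<n. T i j = (\<Sum>k<n. adj (Y k i) * Y k j)"
  proof (rule matrix_square_if_form_positive)
    fix i j assume ij: "i < n" "j < n"
    have "(\<lambda>U. cnj (H i j U)) = H j i" by (simp add: H_def mult.commute)
    then show "adj (T i j) = T j i" using adj_povm_integral[OF H[OF ij]] by (simp add: T_def)
  next
    fix x :: "nat \<Rightarrow> 'a"
    let ?F = "(\<lambda>(i, j). H i j) ` ({..<n} \<times> {..<n})"
    have "finite ?F" "?F \<subseteq> CS" using H by auto
    from povm_integral_simultaneous[OF \<mu> this] obtain Q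
      where Q: "\<forall>h\<in>?F. (\<lambda>m. riemann_sum \<mu> h (Q m)) \<longlonglongrightarrow> povm_integral \<mu> h" ..
    let ?S = "\<lambda>P. \<Sum>i<n. \<Sum>j<n. adj (x i) * riemann_sum \<mu> (H i j) P * x j"
    have "(\<lambda>m. riemann_sum \<mu> (H i j) (Q m)) \<longlonglongrightarrow> T i j" if "i < n" "j < n" for i j
      unfolding T_def using that by (intro Q[rule_format]) auto
    then have "(\<lambda>m. ?S (Q m)) \<longlonglongrightarrow> vec_ip n x (mat_vec n T x)"
      unfolding vec_ip_mat_vec by (intro tendsto_intros) auto
    moreover have "A_pos (?S P)" for P
    proof -
      let ?t = "\<lambda>p i j. scaleC (H i j (stone_point p)) (adj (x i) * \<mu> p * x j)"
      have "?S P = (\<Sum>i<n. \<Sum>j<n. \<Sum>p\<in>P. ?t p i j)"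
        by (simp add: riemann_sum_def sum_distrib_left sum_distrib_right scaleC_mult_left
            scaleC_mult_right)
      also have "\<dots> = (\<Sum>i<n. \<Sum>p\<in>P. \<Sum>j<n. ?t p i j)"
        by (intro sum.cong refl sum.swap)
      also have "\<dots> = (\<Sum>p\<in>P. \<Sum>i<n. \<Sum>j<n. ?t p i j)" by (rule sum.swap)
      also have "A_pos \<dots>"
      proof (rule A_pos_sum)
        fix p
        define w where "w k = (\<Sum>j<n. scaleC (G k j (stone_point p)) (x j))" for k
        let ?u = "\<lambda>k i j. scaleC (cnj (G k i (stone_point p)) * G k j (stone_point p))
          (adj (x i) * \<mu> p * x j)"
        have "adj (w k) * \<mu> p * w k = (\<Sum>j<n. \<Sum>i<n. ?u k i j)" for k
          by (simp add: w_def adj_sum adj_scaleC sum_distrib_left sum_distrib_right scaleC_mult_left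
              scaleC_mult_right scaleC_scaleC scaleC_sum_right mult.commute)
        then have "adj (w k) * \<mu> p * w k = (\<Sum>i<n. \<Sum>j<n. ?u k i j)" for k
          by (subst sum.swap) simp
        then have "(\<Sum>k<n. adj (w k) * \<mu> p * w k) = (\<Sum>k<n. \<Sum>i<n. \<Sum>j<n. ?u k i j)" by simp
        also have "\<dots> = (\<Sum>i<n. \<Sum>k<n. \<Sum>j<n. ?u k i j)" by (rule sum.swap)
        also have "\<dots> = (\<Sum>i<n. \<Sum>j<n. \<Sum>k<n. ?u k i j)"
          by (intro sum.cong refl sum.swap)
        also have "\<dots> = (\<Sum>i<n. \<Sum>j<n. ?t p i j)"
          by (simp add: H_def scaleC_sum_left)
        finally show "A_pos (\<Sum>i<n. \<Sum>j<n. ?t p i j)"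
          using povm_A_pos[OF \<mu>, of p] A_pos_sum[of "{..<n}" "\<lambda>k. adj (w k) * \<mu> p * w k"]
          by (simp add: A_pos_conj)
      qed
      finally show ?thesis .
    qed
    ultimately show "A_pos (vec_ip n x (mat_vec n T x))"
      by (rule A_pos_limit)
  qed
  then show "\<exists>Y. \<forall>i<n. \<forall>j<n. povm_integral \<mu> (\<lambda>U. \<Sum>k<n. cnj (G k i U) * G k j U)
      = (\<Sum>k<n. adj (Y k i) * Y k j)"
    by (simp add: T_def H_def)
qed

end

section \<open>Uniqueness\<close>

lemma C_linear_add: "C_linear \<psi> \<Longrightarrow> f \<in> CS \<Longrightarrow> g \<in> CS \<Longrightarrow> \<psi> (\<lambda>U. f U + g U) = \<psi> f + \<psi> g"
  by (simp add: C_linear_def)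

lemma C_linear_scale: "C_linear \<psi> \<Longrightarrow> f \<in> CS \<Longrightarrow> \<psi> (\<lambda>U. c * f U) = scaleC c (\<psi> f)"
  by (simp add: C_linear_def)

lemma C_linear_0: "C_linear \<psi> \<Longrightarrow> \<psi> (\<lambda>U. 0) = 0"
  using C_linear_scale[of \<psi> "\<lambda>U. 0" 0] by (simp add: CS_0)

lemma C_linear_diff:
  assumes "C_linear \<psi>" "f \<in> CS" "g \<in> CS"
  shows "\<psi> (\<lambda>U. f U - g U) = \<psi> f - \<psi> g"
  using C_linear_add[OF assms(1,2) CS_scale[OF assms(3)], of "-1"]
    C_linear_scale[OF assms(1,3), of "-1"]
  by (simp add: scaleC_minus_left scaleC_one)

lemma C_linear_sum:
  assumes "C_linear \<psi>" "\<And>i. i \<in> I \<Longrightarrow> f i \<in> CS"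
  shows "\<psi> (\<lambda>U. \<Sum>i\<in>I. f i U) = (\<Sum>i\<in>I. \<psi> (f i))"
  using assms(2)
  by (induction I rule: infinite_finite_induct)
    (simp_all add: C_linear_0[OF assms(1)] C_linear_add[OF assms(1)] CS_sum)

lemma step_function_apply:
  assumes P: "stone_partition top P" and U: "U \<in> stone" and p: "p \<in> P" "p \<in> U"
  shows "(\<Sum>q\<in>P. c q * chi q U) = c p"
proof -
  have "c q * chi q U = (if q = p then c p else 0)" if "q \<in> P" for q
  proof (cases "q = p")
    case False
    then have "inf q p \<notin> U"
      using stone_partitionD(2)[OF P that p(1)] stone_bot_notin[OF U] by simp
    then show ?thesis using False p(2) by (simp add: chi_apply[OF U] stone_inf_iff[OF U])
  qed (use p in \<open>simp add: chi_apply[OF U]\<close>)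
  then have "(\<Sum>q\<in>P. c q * chi q U) = (\<Sum>q\<in>P. if q = p then c p else 0)"
    by (rule sum.cong[OF refl])
  then show ?thesis using stone_partitionD(1)[OF P] p(1) by simp
qed

text \<open>The Riemann sum is the value of \<open>\<psi>\<close> at a step function
  \<open>g\<close> within \<open>e\<close> of \<open>f\<close>. For real \<open>f\<close> both
  \<open>e + (g - f)\<close> and \<open>e - (g - f)\<close> are nonnegative, so positivity bounds
  \<open>\<psi> g - \<psi> f\<close> by \<open>e\<close>.\<close>

lemma positive_linear_eq_povm_integral_real:
  fixes \<psi> :: "('b::boolean_algebra set \<Rightarrow> complex) \<Rightarrow> 'a::cstar_algebra"
  assumes \<mu>: "povm \<mu>" and lin: "C_linear \<psi>" and pos: "C_positive \<psi>"
    and chi: "\<And>p. \<psi> (chi p) = \<mu> p" and f: "f \<in> CS" and real: "\<And>U. Im (f U) = 0"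
  shows "povm_integral \<mu> f = \<psi> f"
proof (rule povm_integral_eqI[OF \<mu> f])
  fix P e assume P: "fine_partition f P e"
  then have part: "stone_partition top P" and e: "0 \<le> e" by (auto simp: fine_partition_def)
  define g where "g = (\<lambda>U. \<Sum>p\<in>P. f (stone_point p) * chi p U)"
  have g: "g \<in> CS" unfolding g_def by (intro CS_sum CS_scale chi_CS)
  have "\<psi> g = (\<Sum>p\<in>P. \<psi> (\<lambda>U. f (stone_point p) * chi p U))"
    unfolding g_def by (rule C_linear_sum[OF lin CS_scale[OF chi_CS]])
  then have \<psi>g: "\<psi> g = riemann_sum \<mu> f P"
    by (simp add: riemann_sum_def C_linear_scale[OF lin chi_CS] chi)
  have close: "cmod (g U - f U) \<le> e" "Im (g U) = 0" if U: "U \<in> stone" for U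
  proof -
    obtain p where p: "p \<in> P" "p \<in> U"
      using stone_partitionD(3)[OF part U] stone_top_mem[OF U] by blast
    have gU: "g U = f (stone_point p)"
      unfolding g_def by (rule step_function_apply[OF part U p])
    have "p \<noteq> bot" using p(2) stone_bot_notin[OF U] by auto
    from stone_point[OF this] show "cmod (g U - f U) \<le> e"
      unfolding gU using fine_partition_cmod_le[OF P p(1) _ U _ p(2)] by blast
    show "Im (g U) = 0" by (simp add: gU real)
  qed
  have psi_e: "\<psi> (\<lambda>U. of_real e * chi top U) = of_real e"
    unfolding C_linear_scale[OF lin chi_CS] chi povm_top[OF \<mu>] scaleC_of_real
    by (simp add: of_real_def)
  have eCS: "(\<lambda>U. of_real e * chi top U) \<in> CS" by (intro CS_scale chi_CS)
  have re: "\<bar>Re (g U) - Re (f U)\<bar> \<le> e" if "U \<in> stone" for U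
    using abs_Re_le_cmod[of "g U - f U"] close(1)[OF that] by simp
  have "A_pos (\<psi> (\<lambda>U. of_real e * chi top U - (g U - f U)))"
  proof (rule pos[unfolded C_positive_def, rule_format])
    show "(\<lambda>U. of_real e * chi top U - (g U - f U)) \<in> CS"
      by (intro CS_diff eCS g f)
    fix U :: "'b set" assume U: "U \<in> stone"
    show "Im (of_real e * chi top U - (g U - f U)) = 0 \<and> 0 \<le> Re (of_real e * chi top U - (g U - f U))"
      using re[OF U] close(2)[OF U] real by (simp add: chi_apply[OF U] stone_top_mem[OF U])
  qed
  moreover have "A_pos (\<psi> (\<lambda>U. of_real e * chi top U + (g U - f U)))"
  proof (rule pos[unfolded C_positive_def, rule_format])
    show "(\<lambda>U. of_real e * chi top U + (g U - f U)) \<in> CS"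
      by (intro CS_diff CS_add eCS g f)
    fix U :: "'b set" assume U: "U \<in> stone"
    show "Im (of_real e * chi top U + (g U - f U)) = 0 \<and> 0 \<le> Re (of_real e * chi top U + (g U - f U))"
      using re[OF U] close(2)[OF U] real by (simp add: chi_apply[OF U] stone_top_mem[OF U])
  qed
  ultimately have "norm (\<psi> g - \<psi> f) \<le> e"
    by (intro norm_le_if_A_pos e)
      (simp_all only: C_linear_diff[OF lin eCS CS_diff[OF g f]] C_linear_add[OF lin eCS CS_diff[OF g f]]
        C_linear_diff[OF lin g f] psi_e)
  then show "norm (riemann_sum \<mu> f P - \<psi> f) \<le> 2 * e" using e by (simp add: \<psi>g)
qed

lemma positive_linear_eq_povm_integral:
  fixes \<psi> :: "('b::boolean_algebra set \<Rightarrow> complex) \<Rightarrow> 'a::cstar_algebra"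
  assumes \<mu>: "povm \<mu>" and lin: "C_linear \<psi>" and pos: "C_positive \<psi>"
    and chi: "\<And>p. \<psi> (chi p) = \<mu> p" and f: "f \<in> CS"
  shows "\<psi> f = povm_integral \<mu> f"
proof -
  let ?re = "\<lambda>U. complex_of_real (Re (f U))" and ?im = "\<lambda>U. complex_of_real (Im (f U))"
  have CS: "?re \<in> CS" "?im \<in> CS" using f by (simp_all add: CS_Re CS_Im)
  have split: "\<phi> f = \<phi> ?re + scaleC \<i> (\<phi> ?im)" if \<phi>: "C_linear \<phi>"
    for \<phi> :: "('b set \<Rightarrow> complex) \<Rightarrow> 'a"
  proof -
    have "f = (\<lambda>U. ?re U + \<i> * ?im U)" using complex_eq by auto
    then have "\<phi> f = \<phi> (\<lambda>U. ?re U + \<i> * ?im U)" by (rule arg_cong)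
    also have "\<dots> = \<phi> ?re + \<phi> (\<lambda>U. \<i> * ?im U)" by (rule C_linear_add[OF \<phi> CS(1) CS_scale[OF CS(2)]])
    finally show ?thesis by (simp only: C_linear_scale[OF \<phi> CS(2)])
  qed
  have "povm_integral \<mu> ?re = \<psi> ?re" "povm_integral \<mu> ?im = \<psi> ?im"
    by (rule positive_linear_eq_povm_integral_real[OF \<mu> lin pos chi]; simp add: CS)+
  then show ?thesis
    using split[OF lin] split[OF C_linear_povm_integral[OF \<mu>]] by (simp only:)
qed

section \<open>Sigma-normality\<close>

text \<open>A level set of \<open>Re g\<close> is closed but in general not clopen. The gap between
  \<open>e\<close> and \<open>2 * e\<close> absorbs the oscillation on a fine partition, whose
  pieces meeting the upper level set are joined.\<close>

lemma clopen_between: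
  fixes g :: "'b::boolean_algebra set \<Rightarrow> complex"
  assumes g: "g \<in> CS" and e: "0 < e"
  obtains p where "\<And>U. U \<in> stone \<Longrightarrow> p \<in> U \<Longrightarrow> e \<le> Re (g U)"
    "\<And>U. U \<in> stone \<Longrightarrow> 2 * e \<le> Re (g U) \<Longrightarrow> p \<in> U"
proof -
  obtain P where P: "fine_partition g P e"
    using fine_partition_exists_single[OF g e] by blast
  then have part: "stone_partition top P" by (simp add: fine_partition_def)
  define Q where "Q = {p\<in>P. \<exists>U\<in>stone. p \<in> U \<and> 2 * e \<le> Re (g U)}"
  have "finite Q" using stone_partitionD(1)[OF part] by (simp add: Q_def)
  then obtain s where s: "\<And>U. U \<in> stone \<Longrightarrow> s \<in> U \<longleftrightarrow> (\<exists>p\<in>Q. p \<in> U)"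
    by (rule stone_finite_union) (rule that)
  show thesis
  proof (rule that)
    fix U :: "'b set" assume U: "U \<in> stone" "s \<in> U"
    then obtain p where p: "p \<in> P" "p \<in> U" "p \<in> Q" using s Q_def by blast
    then obtain V where V: "V \<in> stone" "p \<in> V" "2 * e \<le> Re (g V)" unfolding Q_def by blast
    have "Re (g V) - Re (g U) \<le> e"
      using fine_partition_cmod_le[OF P p(1) V(1) U(1) V(2) p(2)] abs_Re_le_cmod[of "g V - g U"]
      by simp
    then show "e \<le> Re (g U)" using V(3) by simp
  next
    fix U :: "'b set" assume U: "U \<in> stone" "2 * e \<le> Re (g U)"
    obtain p where "p \<in> P" "p \<in> U"
      using stone_partitionD(3)[OF part U(1)] stone_top_mem[OF U(1)] by blast
    then show "s \<in> U" using s U unfolding Q_def by blast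
  qed
qed

lemma C_le_povm_integral:
  assumes \<mu>: "povm \<mu>" and fg: "f \<in> CS" "g \<in> CS" "C_sa f" "C_sa g" "C_le f g"
  shows "A_le (povm_integral \<mu> f) (povm_integral \<mu> g)"
proof -
  have "A_pos (povm_integral \<mu> (\<lambda>U. g U - f U))"
    using C_positive_povm_integral[OF \<mu>] CS_diff[OF fg(2,1)] fg(3-5)
    by (simp add: C_positive_def C_sa_def C_le_def)
  then show ?thesis
    by (simp add: A_le_def C_linear_diff[OF C_linear_povm_integral[OF \<mu>] fg(2,1)])
qed

text \<open>A decreasing sequence with infimum \<open>bot\<close> is turned into the disjoint sequence of its
  successive differences, on which countable additivity applies.\<close>

lemma povm_decreasing_to_bot:
  fixes \<mu> :: "'b::boolean_algebra \<Rightarrow> 'a::cstar_algebra"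
  assumes \<mu>: "povm \<mu>" and dec: "\<And>n. r (Suc n) \<le> r n"
    and inf: "\<And>t. (\<And>n. t \<le> r n) \<Longrightarrow> t = bot"
    and z: "A_sa z" "\<And>n. A_le z (\<mu> (r n))"
  shows "A_le z 0"
proof -
  \<comment> \<open>Starting with \<open>- r 0\<close> makes the \<open>q n\<close> exhaust
    \<open>top\<close>, so that their first \<open>Suc n\<close> measures add up to
    \<open>1 - \<mu> (r n)\<close>.\<close>
  define q where "q n = (if n = 0 then - r 0 else inf (r (n - 1)) (- r n))" for n
  have mono: "r m \<le> r n" if "n \<le> m" for n m
    using that by (induction rule: dec_induct) (auto intro: order_trans[OF dec])
  have disj: "inf (q n) (q m) = bot" if "n < m" for n m
  proof (rule stone_eqI)
    fix U :: "'b set" assume U: "U \<in> stone"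
    have "r (m - 1) \<le> r n" using that by (intro mono) simp
    then show "inf (q n) (q m) \<in> U \<longleftrightarrow> bot \<in> U"
      using that stone_upward[OF U, of "r (m - 1)" "r n"] by (auto simp: q_def stone_simps[OF U])
  qed
  have disj': "inf (q n) (q m) = bot" if "n \<noteq> m" for n m
    using disj[of n m] disj[of m n] that by (cases "n < m") (auto simp: inf_commute)
  have lub: "B_is_lub top (range q)"
    unfolding B_is_lub_def
  proof (intro conjI ballI allI impI)
    fix t assume t: "\<forall>p\<in>range q. p \<le> t"
    have "- t \<le> r n" for n
    proof (rule stone_leI)
      fix U :: "'b set" assume U: "U \<in> stone" "- t \<in> U"
      have "q k \<notin> U" for k
        using t U stone_upward[OF U(1), of "q k" t] by (auto simp: stone_compl_iff)
      then show "r n \<in> U"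
      proof (induction n)
        case 0
        show ?case using 0[of 0] by (simp add: q_def stone_simps[OF U(1)])
      next
        case (Suc n)
        then show ?case using Suc.prems[of "Suc n"] by (simp add: q_def stone_simps[OF U(1)])
      qed
    qed
    then have "- t = bot" by (rule inf)
    then show "top \<le> t" by (metis compl_bot_eq double_compl order_refl)
  qed simp
  have sup: "A_is_sup (\<lambda>n. \<Sum>k<n. \<mu> (q k)) (\<mu> top)"
    by (rule povm_sup_sequence[OF \<mu> disj' lub])
  have part: "(\<Sum>k<Suc n. \<mu> (q k)) = 1 - \<mu> (r n)" for n
  proof (induction n)
    case 0
    have "\<mu> (sup (r 0) (- r 0)) = \<mu> (r 0) + \<mu> (- r 0)" by (rule povm_sup[OF \<mu>]) simp
    then show ?case by (simp add: q_def povm_top[OF \<mu>] eq_diff_eq add.commute)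
  next
    case (Suc n)
    have eq: "sup (r (Suc n)) (q (Suc n)) = r n"
      using dec[of n] by (simp add: q_def sup_inf_distrib1 sup_absorb2)
    have "\<mu> (sup (r (Suc n)) (q (Suc n))) = \<mu> (r (Suc n)) + \<mu> (q (Suc n))"
      by (rule povm_sup[OF \<mu>]) (simp add: q_def inf_left_commute)
    then show ?case using Suc unfolding eq by simp
  qed
  have "A_le (\<Sum>k<n. \<mu> (q k)) (1 - z)" for n
  proof -
    \<comment> \<open>\<open>part\<close> covers only nonempty sums, hence the passage to one more
      term.\<close>
    have "A_le (\<Sum>k<n. \<mu> (q k)) (\<Sum>k<Suc n. \<mu> (q k))"
      by (simp add: A_le_def povm_A_pos[OF \<mu>])
    also have "A_le \<dots> (1 - z)" using z(2)[of n] unfolding part by (simp add: A_le_def)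
    finally show ?thesis .
  qed
  moreover have "A_sa (1 - z)" using z(1) by (simp add: A_sa_simps)
  ultimately have "A_le 1 (1 - z)" using sup unfolding A_is_sup_def povm_top[OF \<mu>] by simp
  then show ?thesis by (simp add: A_le_def)
qed

text \<open>For an upper bound \<open>y\<close> of the integrals of the \<open>s n\<close>, the
  excess \<open>d\<close> is at most the integral of \<open>f - s n\<close>, hence at most
  \<open>2 * e + K * \<mu> (r n)\<close>. \<open>povm_decreasing_to_bot\<close> removes the last
  term, and \<open>e\<close> is arbitrary.\<close>

lemma C_sigma_normal_povm_integral:
  fixes \<mu> :: "'b::boolean_algebra \<Rightarrow> 'a::cstar_algebra"
  assumes \<mu>: "povm \<mu>"
  shows "C_sigma_normal (povm_integral \<mu>)"
  unfolding C_sigma_normal_def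
proof (intro allI impI, elim conjE exE)
  fix s :: "nat \<Rightarrow> 'b set \<Rightarrow> complex" and f and M :: real
  assume s: "\<forall>n. s n \<in> CS \<and> C_sa (s n)" and M: "\<forall>n U. cmod (s n U) \<le> M"
    and inc: "\<forall>n. C_le (s n) (s (Suc n))" and sup: "C_is_sup s f"
  have f: "f \<in> CS" "C_sa f" and ub: "\<And>n. C_le (s n) f"
    and least: "\<And>g. g \<in> CS \<Longrightarrow> C_sa g \<Longrightarrow> (\<And>n. C_le (s n) g) \<Longrightarrow> C_le f g"
    using sup by (simp_all add: C_is_sup_def)
  note lin = C_linear_povm_integral[OF \<mu>]
  have le: "A_le (povm_integral \<mu> (s n)) (povm_integral \<mu> f)" for n
    using s f ub by (intro C_le_povm_integral[OF \<mu>]) simp_all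
  have saf: "A_sa (povm_integral \<mu> f)"
  proof -
    have "(\<lambda>U. cnj (f U)) = f" using f(2) by (auto simp: C_sa_def complex_eq_iff)
    then show ?thesis using adj_povm_integral[OF \<mu> f(1)] by (simp add: A_sa_def)
  qed
  have M0: "0 \<le> M" using M norm_ge_zero order_trans by blast
  have sM: "\<bar>Re (s n U)\<bar> \<le> M" for n U using M abs_Re_le_cmod order_trans by blast
  \<comment> \<open>The constant \<open>M\<close> competes with \<open>f\<close> as a continuous
    upper bound of the sequence.\<close>
  have fM: "Re (f U) \<le> M" if U: "U \<in> stone" for U
  proof -
    have "C_le f (\<lambda>U. of_real M * chi top U)"
    proof (rule least)
      show "C_le (s n) (\<lambda>U. of_real M * chi top U)" for n
        using sM[of n] by (auto simp: C_le_def chi_apply stone_top_mem abs_le_iff)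
      show "(\<lambda>U. of_real M * chi top U) \<in> CS" by (intro CS_scale chi_CS)
      show "C_sa (\<lambda>U. of_real M * chi top U)" by (simp add: C_sa_def chi_def)
    qed
    then show ?thesis using U by (auto simp: C_le_def chi_apply stone_top_mem)
  qed
  have smono: "Re (s k U) \<le> Re (s n U)" if "k \<le> n" "U \<in> stone" for k n U
    using that(1)
  proof (induction rule: dec_induct)
    case (step n)
    have "Re (s n U) \<le> Re (s (Suc n) U)" using inc that(2) unfolding C_le_def by blast
    then show ?case using step by simp
  qed simp
  \<comment> \<open>\<open>2 * M\<close> bounds \<open>f - s n\<close>; the extra \<open>1\<close>
    permits division by \<open>K\<close>.\<close>
  define K where "K = 2 * M + 1"
  have K: "0 < K" using M0 by (simp add: K_def)
  show "A_is_sup (\<lambda>n. povm_integral \<mu> (s n)) (povm_integral \<mu> f)"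
    unfolding A_is_sup_def
  proof (intro conjI allI impI saf le)
    fix y assume y: "A_sa y \<and> (\<forall>n. A_le (povm_integral \<mu> (s n)) y)"
    define d where "d = povm_integral \<mu> f - y"
    have sad: "A_sa d" using saf y by (simp add: d_def A_sa_simps)
    have "A_le d (of_real (2 * e))" if e: "0 < e" for e
    proof -
      have g: "(\<lambda>U. f U - s n U) \<in> CS" for n using f s by (simp add: CS_diff)
      have "\<exists>p. (\<forall>U\<in>stone. p \<in> U \<longrightarrow> e \<le> Re (f U - s n U)) \<and>
          (\<forall>U\<in>stone. 2 * e \<le> Re (f U - s n U) \<longrightarrow> p \<in> U)" for n
        by (rule clopen_between[OF g[of n] e]) blast
      then obtain p where
        p1: "\<And>n U. U \<in> stone \<Longrightarrow> p n \<in> U \<Longrightarrow> e \<le> Re (f U - s n U)" and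
        p2: "\<And>n U. U \<in> stone \<Longrightarrow> 2 * e \<le> Re (f U - s n U) \<Longrightarrow> p n \<in> U"
        by metis
      \<comment> \<open>The meets are decreasing, and nothing is lost: by monotonicity of
        \<open>s\<close>, missing one \<open>p k\<close> with \<open>k \<le> n\<close> already keeps
        \<open>f - s n\<close> below \<open>2 * e\<close>.\<close>
      define r where "r = rec_nat (p 0) (\<lambda>n q. inf q (p (Suc n)))"
      have r0: "r 0 = p 0" and rSuc: "\<And>n. r (Suc n) = inf (r n) (p (Suc n))"
        by (simp_all add: r_def)
      have r_iff: "r n \<in> U \<longleftrightarrow> (\<forall>k\<le>n. p k \<in> U)" if U: "U \<in> stone" for n U
        by (induction n) (auto simp: r0 rSuc stone_inf_iff[OF U] le_Suc_eq)
      have "A_le ((1 / K) *\<^sub>R (d - of_real (2 * e))) 0"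
      proof (rule povm_decreasing_to_bot[OF \<mu>, where r=r])
        show "r (Suc n) \<le> r n" for n by (simp add: rSuc)
        show "A_sa ((1 / K) *\<^sub>R (d - of_real (2 * e)))"
          using sad A_sa_simps(3)[of "2 * e"] by (intro A_sa_simps)
      next
        fix t assume t: "\<And>n. t \<le> r n"
        have te: "e \<le> Re (f U - s n U)" if "U \<in> stone" "t \<in> U" for n U
          using stone_upward[OF that(1,2) t[of n]] r_iff[OF that(1), of n] by (intro p1[OF that(1)]) blast
        show "t = bot"
        proof (rule ccontr)
          assume "t \<noteq> bot"
          then obtain V where V: "V \<in> stone" "t \<in> V" by (rule stone_point_exists)
          \<comment> \<open>On \<open>t\<close> every \<open>s n\<close> is at least
            \<open>e\<close> below \<open>f\<close>, so the lowered function is still an upper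
            bound; at \<open>V\<close> this contradicts minimality of \<open>f\<close>.\<close>
          have "C_le f (\<lambda>U. f U - of_real e * chi t U)"
          proof (rule least)
            show "(\<lambda>U. f U - of_real e * chi t U) \<in> CS" by (intro CS_diff f CS_scale chi_CS)
            show "C_sa (\<lambda>U. f U - of_real e * chi t U)" using f(2) by (simp add: C_sa_def chi_def)
            show "C_le (s n) (\<lambda>U. f U - of_real e * chi t U)" for n
              unfolding C_le_def
            proof
              fix U :: "'b set" assume U: "U \<in> stone"
              show "Re (s n U) \<le> Re (f U - of_real e * chi t U)"
                using te[OF U, of n] ub[of n] U by (auto simp: chi_apply[OF U] C_le_def)
            qed
          qed
          then show False using V e by (auto simp: C_le_def chi_apply)
        qed
      next
        fix n
        let ?h = "\<lambda>U. of_real (2 * e) * chi top U + of_real K * chi (r n) U"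
        have h: "?h \<in> CS" by (intro CS_add CS_scale chi_CS)
        have "A_le (povm_integral \<mu> (\<lambda>U. f U - s n U)) (povm_integral \<mu> ?h)"
        proof (rule C_le_povm_integral[OF \<mu> g h])
          show "C_sa (\<lambda>U. f U - s n U)" "C_sa ?h" using f(2) s by (simp_all add: C_sa_def chi_def)
          show "C_le (\<lambda>U. f U - s n U) ?h"
            unfolding C_le_def
          proof
            fix U :: "'b set" assume U: "U \<in> stone"
            show "Re (f U - s n U) \<le> Re (?h U)"
            proof (cases "r n \<in> U")
              case True
              then show ?thesis using fM[OF U] sM[of n U] e
                by (simp add: chi_apply[OF U] stone_top_mem[OF U] K_def abs_le_iff)
            next
              case False
              then obtain k where k: "k \<le> n" "p k \<notin> U" using r_iff[OF U] by blast
              then have "Re (f U - s k U) < 2 * e" using p2[OF U] not_le by blast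
              then show ?thesis using smono[OF k(1) U] False
                by (simp add: chi_apply[OF U] stone_top_mem[OF U])
            qed
          qed
        qed
        moreover have "povm_integral \<mu> (\<lambda>U. f U - s n U) = povm_integral \<mu> f - povm_integral \<mu> (s n)"
          using s by (intro C_linear_diff[OF lin f(1)]) simp
        moreover have "povm_integral \<mu> ?h = of_real (2 * e) + K *\<^sub>R \<mu> (r n)"
          unfolding C_linear_add[OF lin CS_scale[OF chi_CS] CS_scale[OF chi_CS]]
            C_linear_scale[OF lin chi_CS] povm_integral_chi[OF \<mu>] povm_top[OF \<mu>] scaleC_of_real
          by (simp add: of_real_def)
        moreover have "A_le d (povm_integral \<mu> f - povm_integral \<mu> (s n))"
          using y by (simp add: A_le_def d_def)
        ultimately have "A_le d (of_real (2 * e) + K *\<^sub>R \<mu> (r n))" using A_le_trans by metis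
        then have "A_le (d - of_real (2 * e)) (K *\<^sub>R \<mu> (r n))" by (simp add: A_le_def algebra_simps)
        from A_le_scaleR[OF this, of "1 / K"]
        show "A_le ((1 / K) *\<^sub>R (d - of_real (2 * e))) (\<mu> (r n))"
          using K by simp
      qed
      from A_le_scaleR[OF this, of K] have "A_le (d - of_real (2 * e)) 0" using K by simp
      then show ?thesis by (simp add: A_le_def)
    qed
    then have bound: "A_pos (of_real (2 * e) - d)" if "0 < e" for e using that by (simp only: A_le_def)
    have "A_pos (- d)"
    proof (rule A_pos_if_arbitrarily_close)
      fix e :: real assume e: "0 < e"
      show "\<exists>y. A_pos y \<and> norm (y - - d) \<le> e"
        using bound[of "e / 2"] e by (intro exI[of _ "of_real e - d"]) simp
    qed
    then show "A_le (povm_integral \<mu> f) y" by (simp add: A_le_def d_def)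
  qed
qed

section \<open>The POVM of a sigma-normal map\<close>

lemma sum_chi_disjoint:
  fixes q :: "nat \<Rightarrow> 'b::boolean_algebra"
  assumes disj: "\<And>n m. n \<noteq> m \<Longrightarrow> inf (q n) (q m) = bot" and U: "U \<in> stone"
  shows "(\<Sum>k<n. chi (q k) U) = (if \<exists>k<n. q k \<in> U then 1 else 0)"
proof (cases "\<exists>k<n. q k \<in> U")
  case True
  then obtain k where k: "k < n" "q k \<in> U" by blast
  have "chi (q j) U = (if j = k then 1 else 0)" for j
  proof (cases "j = k")
    case False
    then have "inf (q j) (q k) \<notin> U" using disj[OF False] stone_bot_notin[OF U] by simp
    then show ?thesis using False k(2) by (simp add: chi_apply[OF U] stone_inf_iff[OF U])
  qed (use k in \<open>simp add: chi_apply[OF U]\<close>)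
  then show ?thesis using True k(1) by simp
next
  case False
  then have "(\<Sum>k<n. chi (q k) U) = 0" by (intro sum.neutral) (simp add: chi_apply[OF U])
  then show ?thesis unfolding if_not_P[OF False] .
qed

text \<open>Each indicator is its own square, so complete positivity on 1 by 1 matrices makes its
  image positive. For additivity, \<open>chi t\<close> has to be the supremum of the partial sums
  within \<open>CS\<close>, although pointwise they may stay \<open>0\<close> at points of
  \<open>t\<close> outside all \<open>q k\<close>.\<close>

lemma povm_if_sigma_normal:
  fixes \<phi> :: "('b::boolean_algebra set \<Rightarrow> complex) \<Rightarrow> 'a::cstar_algebra"
  assumes lin: "C_linear \<phi>" and cp: "C_completely_positive \<phi>" and unital: "C_unital \<phi>"
    and normal: "C_sigma_normal \<phi>"
  shows "povm (\<lambda>p. \<phi> (chi p))"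
  unfolding povm_def
proof (intro conjI allI impI)
  fix p :: 'b
  have "\<forall>i<1::nat. \<forall>j<1::nat. chi p \<in> CS" by (simp add: chi_CS)
  from cp[unfolded C_completely_positive_def, THEN spec[of _ 1], THEN spec[of _ "\<lambda>_ _. chi p"],
      THEN mp, OF this]
  obtain Y :: "nat \<Rightarrow> nat \<Rightarrow> 'a" where "\<forall>i<1. \<forall>j<1.
      \<phi> (\<lambda>U. \<Sum>k<1::nat. cnj (chi p U) * chi p U) = (\<Sum>k<1. adj (Y k i) * Y k j)" ..
  then have "\<phi> (\<lambda>U. \<Sum>k<1::nat. cnj (chi p U) * chi p U) = (\<Sum>k<1. adj (Y k 0) * Y k 0)"
    by (simp only: less_one)
  moreover have "(\<lambda>U. \<Sum>k<1::nat. cnj (chi p U) * chi p U) = chi p" by (auto simp: chi_def)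
  ultimately have "\<phi> (chi p) = adj (Y 0 0) * Y 0 0" by simp
  then show "A_pos (\<phi> (chi p))" by (simp add: A_pos_adj_mult_self)
next
  show "\<phi> (chi top) = 1" using unital by (simp add: C_unital_def)
next
  fix q :: "nat \<Rightarrow> 'b" and t
  assume "(\<forall>n m. n \<noteq> m \<longrightarrow> inf (q n) (q m) = bot) \<and> B_is_lub t (range q)"
  then have disj: "\<And>n m. n \<noteq> m \<Longrightarrow> inf (q n) (q m) = bot" and lub: "B_is_lub t (range q)" by blast+
  have qt: "q k \<le> t" for k using lub by (simp add: B_is_lub_def)
  let ?s = "\<lambda>n U. \<Sum>k<n. chi (q k) U"
  have val: "?s n U = (if \<exists>k<n. q k \<in> U then 1 else 0)" if "U \<in> stone" for n U
    by (rule sum_chi_disjoint[OF disj that])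
  have out: "?s n U = 0" if "U \<notin> stone" for n U using that by (simp add: chi_outside)
  have sCS: "?s n \<in> CS" for n by (intro CS_sum chi_CS)
  have "Im (chi p U) = 0" for p :: 'b and U by (simp add: chi_def)
  then have ssa: "C_sa (?s n)" for n by (simp add: C_sa_def)
  have "C_is_sup ?s (chi t)"
    unfolding C_is_sup_def
  proof (intro conjI allI ballI impI chi_CS)
    show "C_sa (chi t)" by (simp add: C_sa_def chi_def)
    show "C_le (?s n) (chi t)" for n
      unfolding C_le_def
    proof
      fix U :: "'b set" assume U: "U \<in> stone"
      show "Re (?s n U) \<le> Re (chi t U)"
        unfolding val[OF U] unfolding chi_apply[OF U] using stone_upward[OF U _ qt] by auto
    qed
    fix g :: "'b set \<Rightarrow> complex"
    assume g: "g \<in> CS" and "C_sa g \<and> (\<forall>n. C_le (?s n) g)"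
    then have ub: "Re (?s n U) \<le> Re (g U)" if "U \<in> stone" for n U
      using that unfolding C_le_def by blast
    show "C_le (chi t) g"
      unfolding C_le_def
    proof (rule ballI, rule ccontr)
      fix U :: "'b set" assume U: "U \<in> stone" and "\<not> Re (chi t U) \<le> Re (g U)"
      moreover have "0 \<le> Re (g U)" using ub[OF U, of 0] by simp
      ultimately have tU: "t \<in> U" and gU: "Re (g U) < 1"
        by (auto simp: chi_apply[OF U] split: if_splits)
      \<comment> \<open>Around a point of \<open>t\<close> where \<open>g\<close> is below
        \<open>1\<close>, continuity gives a clopen set on which it stays below \<open>1\<close>. No
        \<open>q k\<close> can meet it, so \<open>- p\<close> bounds all \<open>q k\<close> and
        hence \<open>t\<close>.\<close>
      obtain p where p: "p \<in> U" "\<And>V. V \<in> stone \<Longrightarrow> p \<in> V \<Longrightarrow> cmod (g V - g U) < 1 - Re (g U)"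
        using CS_local[OF g U, of "1 - Re (g U)"] gU by auto
      have "q k \<le> - p" for k
      proof (rule stone_leI)
        fix V :: "'b set" assume V: "V \<in> stone" "q k \<in> V"
        have "\<exists>j<Suc k. q j \<in> V" using V(2) by blast
        then have "1 \<le> Re (g V)" using ub[OF V(1), of "Suc k"] unfolding val[OF V(1)] by simp
        then have "1 - Re (g U) \<le> cmod (g V - g U)"
          using complex_Re_le_cmod[of "g V - g U"] by simp
        then have "p \<notin> V" using p(2)[OF V(1)] by auto
        then show "- p \<in> V" by (simp add: stone_compl_iff[OF V(1)])
      qed
      then have "t \<le> - p" using lub by (auto simp: B_is_lub_def)
      then have "- p \<in> U" by (rule stone_upward[OF U tU])
      then show False using p(1) by (simp add: stone_compl_iff[OF U])
    qed
  qed
  moreover have "\<exists>M. \<forall>n U. cmod (?s n U) \<le> M"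
  proof (intro exI allI)
    show "cmod (?s n U) \<le> 1" for n U by (cases "U \<in> stone") (simp_all add: val out)
  qed
  moreover have "C_le (?s n) (?s (Suc n))" for n
    by (simp add: C_le_def chi_def)
  ultimately have "A_is_sup (\<lambda>n. \<phi> (?s n)) (\<phi> (chi t))"
    using normal[unfolded C_sigma_normal_def, rule_format, of ?s "chi t"] sCS ssa by blast
  then show "A_is_sup (\<lambda>n. \<Sum>k<n. \<phi> (chi (q k))) (\<phi> (chi t))"
    by (simp add: C_linear_sum[OF lin chi_CS])
qed

theorem theorem4p16:
  fixes \<mu> :: "'b::boolean_algebra \<Rightarrow> 'a::cstar_algebra"
  assumes "bool_sigma TYPE('b)" and "sigma_cstar TYPE('a)"
  shows "(povm \<mu> \<longrightarrow>
            (\<exists>\<phi>. C_linear \<phi> \<and> C_completely_positive \<phi> \<and> C_unital \<phi> \<and> C_sigma_normal \<phi> \<and>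
                  (\<forall>p. \<phi> (chi p) = \<mu> p) \<and>
                  (\<forall>\<psi>. C_linear \<psi> \<and> C_positive \<psi> \<and> (\<forall>p. \<psi> (chi p) = \<mu> p)
                        \<longrightarrow> (\<forall>f\<in>CS. \<psi> f = \<phi> f))))
       \<and> (\<forall>\<phi>::('b set \<Rightarrow> complex) \<Rightarrow> 'a.
            C_linear \<phi> \<and> C_completely_positive \<phi> \<and> C_unital \<phi> \<and> C_sigma_normal \<phi>
            \<longrightarrow> povm (\<lambda>p. \<phi> (chi p)))"
proof (intro conjI impI allI)
  assume \<mu>: "povm \<mu>"
  show "\<exists>\<phi>. C_linear \<phi> \<and> C_completely_positive \<phi> \<and> C_unital \<phi> \<and> C_sigma_normal \<phi> \<and>
                  (\<forall>p. \<phi> (chi p) = \<mu> p) \<and>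
                  (\<forall>\<psi>. C_linear \<psi> \<and> C_positive \<psi> \<and> (\<forall>p. \<psi> (chi p) = \<mu> p)
                        \<longrightarrow> (\<forall>f\<in>CS. \<psi> f = \<phi> f))"
  proof (intro exI[of _ "povm_integral \<mu>"] conjI allI impI ballI)
    show "C_unital (povm_integral \<mu>)"
      by (simp add: C_unital_def povm_integral_chi[OF \<mu>] povm_top[OF \<mu>])
    show "\<psi> f = povm_integral \<mu> f"
      if "C_linear \<psi> \<and> C_positive \<psi> \<and> (\<forall>p. \<psi> (chi p) = \<mu> p)" "f \<in> CS" for \<psi> f
      using that by (intro positive_linear_eq_povm_integral[OF \<mu>]) simp_all
  qed (rule C_linear_povm_integral[OF \<mu>] C_completely_positive_povm_integral[OF \<mu>]
      C_sigma_normal_povm_integral[OF \<mu>] povm_integral_chi[OF \<mu>])+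
next
  fix \<phi> :: "('b set \<Rightarrow> complex) \<Rightarrow> 'a"
  assume "C_linear \<phi> \<and> C_completely_positive \<phi> \<and> C_unital \<phi> \<and> C_sigma_normal \<phi>"
  then show "povm (\<lambda>p. \<phi> (chi p))" by (simp add: povm_if_sigma_normal)
qed

end
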